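(* Let $X$ be a quasi-projective complex manifold, $f$ a non-invertible holomorphic function on $X$, and $\mathcal S$ a simple holonomic (but not necessarily regular) left $\mathcal D_X$-module such that $\mathcal M:=\mathcal S_f\neq 0$. Then for any $m\in\mathcal M$, $$m\in\mathcal S\iff \omega_{m,0}=0.$$
   Context: $\mathcal S_f$ is the localization of $\mathcal S$ along $\{f=0\}$; $f$ acts injectively on $\mathcal S$, so $\mathcal S\subseteq\mathcal M$, and bijectively on $\mathcal M$. The module $\mathcal M[s]f^s$ carries the left $\mathcal D_X[s]$-action $\xi\cdot(ms^jf^s)=\bigl(\xi(m)s^j+ms^{j+1}\tfrac{\xi(f)}{f}\bigr)f^s$ for vector fields $\xi$, with $s$ acting by multiplication. For $k\in\mathbb Z$, $mf^{s+k}:=(f^km)f^s$. For $m\in\mathcal M$, $\alpha\in\mathbb C$ and an integer $k\ge 0$, let $\ell_k$ be the minimal integer $\ell\ge 0$ for which there is $P\in\mathcal D_X[s]$ with $$P\cdot mf^{s+k}\equiv (s+\alpha)^{\ell}mf^s \pmod{(s+\alpha)^{\ell+1}\cdot\mathcal M[s]f^s}.$$ The sequence $(\ell_k)_k$ stabilizes, and $\omega_{m,\alpha}:=\lim_{k\to\infty}\ell_k$. Here it is used with $\alpha=0$. *)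

theory Defs
  imports "HOL-Analysis.Analysis" "HOL-Algebra.UnivPoly"
begin

section \<open>Quasi-projective complex manifolds\<close>

text \<open>
  Projective space \<open>P(\<complex>\<^sup>N)\<close> is the set of complex lines in \<^typ>\<open>complex^'N\<close>; its
  dimension is \<open>CARD('N) - 1\<close>.
\<close>

definition proj_pt :: "complex^'N \<Rightarrow> (complex^'N) set" where
  "proj_pt v = range (\<lambda>c. c *s v)"

definition proj_space :: "(complex^'N) set set" where
  "proj_space = proj_pt ` {v. v \<noteq> 0}"

definition cone_over :: "(complex^'N) set set \<Rightarrow> (complex^'N) set" where
  "cone_over U = {v. v \<noteq> 0 \<and> proj_pt v \<in> U}"

text \<open>The classical (Euclidean) topology, as a quotient of \<open>\<complex>\<^sup>N - {0}\<close>.\<close>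

definition proj_topology :: "(complex^'N) set topology" where
  "proj_topology = topology (\<lambda>U. U \<subseteq> proj_space \<and> open (cone_over U))"

lemma istopology_proj:
  "istopology (\<lambda>U. U \<subseteq> proj_space \<and> open (cone_over (U :: (complex^'N) set set)))"
proof -
  have 1: "cone_over (U \<inter> V) = cone_over U \<inter> cone_over V" for U V :: "(complex^'N) set set"
    by (auto simp: cone_over_def)
  have 2: "cone_over (\<Union>K) = (\<Union>U\<in>K. cone_over U)" for K :: "(complex^'N) set set set"
    by (auto simp: cone_over_def)
  show ?thesis
    unfolding istopology_def by (auto simp: 1 2)
qed

lemma openin_proj_topology:
  "openin proj_topology U \<longleftrightarrow> U \<subseteq> proj_space \<and> open (cone_over U)"
  unfolding proj_topology_def using topology_inverse'[OF istopology_proj] by metis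

definition homogeneous_poly :: "(complex^'N \<Rightarrow> complex) \<Rightarrow> bool" where
  "homogeneous_poly p \<longleftrightarrow>
     (\<exists>(d::nat) (A :: ('N \<Rightarrow> nat) set) (c :: ('N \<Rightarrow> nat) \<Rightarrow> complex).
        finite A \<and> (\<forall>a\<in>A. (\<Sum>i\<in>UNIV. a i) = d) \<and>
        p = (\<lambda>v. \<Sum>a\<in>A. c a * (\<Prod>i\<in>UNIV. (v $ i) ^ a i)))"

definition zariski_closed :: "(complex^'N) set set \<Rightarrow> bool" where
  "zariski_closed Z \<longleftrightarrow>
     (\<exists>F. (\<forall>p\<in>F. homogeneous_poly p) \<and>
          Z = {proj_pt v | v. v \<noteq> 0 \<and> (\<forall>p\<in>F. p v = 0)})"

text \<open>
  Holomorphic functions of several variables: complex Frechet differentiability. The set \<open>\<Omega>\<close>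
  is meant to be open in \<^typ>\<open>complex^'m\<close> or in one of the coordinate subspaces below.
\<close>

definition holomorphic_fun :: "(complex^'m \<Rightarrow> complex) \<Rightarrow> (complex^'m) set \<Rightarrow> bool" where
  "holomorphic_fun g \<Omega> \<longleftrightarrow>
     (\<forall>a\<in>\<Omega>. \<exists>D. (g has_derivative D) (at a within \<Omega>) \<and> (\<forall>c v. D (c *s v) = c * D v))"

definition holomorphic_map :: "(complex^'m \<Rightarrow> complex^'k) \<Rightarrow> (complex^'m) set \<Rightarrow> bool" where
  "holomorphic_map F \<Omega> \<longleftrightarrow> (\<forall>i. holomorphic_fun (\<lambda>v. F v $ i) \<Omega>)"

text \<open>
  The model space \<open>\<complex>\<^sup>n\<close> with \<open>n = card I\<close>. Using coordinate subspaces of one fixed type lets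
  charts have any dimension (including 0, and varying between connected components) that can
  occur in the given projective space.
\<close>

definition coord_space :: "'m set \<Rightarrow> (complex^'m) set" where
  "coord_space I = {v. \<forall>i. i \<notin> I \<longrightarrow> v $ i = 0}"

abbreviation top_of :: "(complex^'N) set set \<Rightarrow> (complex^'N) set topology" where
  "top_of X \<equiv> subtopology proj_topology X"

text \<open>
  The structure sheaf of a locally closed \<open>X\<close> in projective space: functions which locally extend
  to holomorphic functions on the ambient space. Sections over \<open>U\<close> are normalised to be zero
  outside \<open>U\<close>, so that equality of sections is equality of functions.
\<close>

definition Hol :: "(complex^'N) set set \<Rightarrow> (complex^'N) set set \<Rightarrow> ((complex^'N) set \<Rightarrow> complex) set" where
  "Hol X U = {g. (\<forall>x. x \<notin> U \<longrightarrow> g x = 0) \<and>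
     (\<forall>x\<in>U. \<exists>W G. openin proj_topology W \<and> x \<in> W \<and>
        holomorphic_fun (\<lambda>v. G (proj_pt v)) (cone_over W) \<and> (\<forall>y\<in>U \<inter> W. g y = G y))}"

definition restr :: "'x set \<Rightarrow> ('x \<Rightarrow> complex) \<Rightarrow> 'x \<Rightarrow> complex" where
  "restr U g = (\<lambda>x. if x \<in> U then g x else 0)"

text \<open>A chart is an isomorphism of ringed spaces from an open \<open>U\<close> to an open part of \<open>\<complex>\<^sup>n\<close>.\<close>

definition is_chart ::
    "(complex^'N) set set \<Rightarrow> 'N set \<Rightarrow> (complex^'N) set set \<Rightarrow> ((complex^'N) set \<Rightarrow> complex^'N) \<Rightarrow> bool" where
  "is_chart X I U z \<longleftrightarrow>
     openin (top_of X) U \<and>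
     openin (top_of_set (coord_space I)) (z ` U) \<and>
     homeomorphic_map (subtopology (top_of X) U) (top_of_set (z ` U)) z \<and>
     (\<forall>V g. openin (top_of X) V \<and> V \<subseteq> U \<and> (\<forall>x. x \<notin> V \<longrightarrow> g x = 0) \<longrightarrow>
        (g \<in> Hol X V \<longleftrightarrow> holomorphic_fun (\<lambda>w. g (inv_into U z w)) (z ` V)))"

definition quasi_projective_manifold :: "(complex^'N) set set \<Rightarrow> bool" where
  "quasi_projective_manifold X \<longleftrightarrow>
     (\<exists>A B. zariski_closed A \<and> zariski_closed B \<and> X = A - B) \<and>
     (\<forall>x\<in>X. \<exists>I U z. x \<in> U \<and> is_chart X I U z)"


section \<open>The sheaf of differential operators\<close>

text \<open>
  A section over \<open>U\<close> of the sheaf of \<open>\<complex>\<close>-linear endomorphisms of the structure sheaf is a family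
  of maps, one for each open \<open>V \<subseteq> U\<close>, compatible with restriction; it is normalised to be zero
  wherever it is not meaningful.
\<close>

type_synonym 'x operator = "'x set \<Rightarrow> ('x \<Rightarrow> complex) \<Rightarrow> 'x \<Rightarrow> complex"

definition sheaf_end ::
    "(complex^'N) set set \<Rightarrow> (complex^'N) set set \<Rightarrow> (complex^'N) set operator set" where
  "sheaf_end X U = {P.
     (\<forall>V. openin (top_of X) V \<and> V \<subseteq> U \<longrightarrow>
        (\<forall>g\<in>Hol X V. P V g \<in> Hol X V) \<and>
        (\<forall>g\<in>Hol X V. \<forall>h\<in>Hol X V. P V (\<lambda>x. g x + h x) = (\<lambda>x. P V g x + P V h x)) \<and>
        (\<forall>c. \<forall>g\<in>Hol X V. P V (\<lambda>x. c * g x) = (\<lambda>x. c * P V g x)) \<and>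
        (\<forall>W. \<forall>g\<in>Hol X V. openin (top_of X) W \<and> W \<subseteq> V \<longrightarrow> P W (restr W g) = restr W (P V g))) \<and>
     (\<forall>V g. \<not> (openin (top_of X) V \<and> V \<subseteq> U \<and> g \<in> Hol X V) \<longrightarrow> P V g = (\<lambda>x. 0))}"

definition op_zero :: "'x operator" where
  "op_zero = (\<lambda>V g x. 0)"

definition op_add :: "'x operator \<Rightarrow> 'x operator \<Rightarrow> 'x operator" where
  "op_add P Q = (\<lambda>V g x. P V g x + Q V g x)"

definition op_comp :: "'x operator \<Rightarrow> 'x operator \<Rightarrow> 'x operator" where
  "op_comp P Q = (\<lambda>V g. P V (Q V g))"

definition op_res :: "'x set \<Rightarrow> 'x operator \<Rightarrow> 'x operator" where
  "op_res W P = (\<lambda>V g. if V \<subseteq> W then P V g else (\<lambda>x. 0))"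

text \<open>Multiplication by a function that is holomorphic on (at least) \<open>U\<close>.\<close>

definition mul_op ::
    "(complex^'N) set set \<Rightarrow> (complex^'N) set set \<Rightarrow> ((complex^'N) set \<Rightarrow> complex) \<Rightarrow> (complex^'N) set operator" where
  "mul_op X U g = (\<lambda>V h x. if openin (top_of X) V \<and> V \<subseteq> U \<and> h \<in> Hol X V then g x * h x else 0)"

definition vector_fields ::
    "(complex^'N) set set \<Rightarrow> (complex^'N) set set \<Rightarrow> (complex^'N) set operator set" where
  "vector_fields X U = {\<xi> \<in> sheaf_end X U.
     \<forall>V. openin (top_of X) V \<and> V \<subseteq> U \<longrightarrow>
       (\<forall>g\<in>Hol X V. \<forall>h\<in>Hol X V.
          \<xi> V (\<lambda>x. g x * h x) = (\<lambda>x. \<xi> V g x * h x + g x * \<xi> V h x))}"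

text \<open>
  The operators over \<open>U\<close> which are sums of products of functions and at most \<open>p\<close> vector fields,
  all defined on the whole of \<open>U\<close>.
\<close>

inductive diff_gen ::
    "(complex^'N) set set \<Rightarrow> (complex^'N) set set \<Rightarrow> nat \<Rightarrow> (complex^'N) set operator \<Rightarrow> bool"
  for X U where
  gen_fun: "g \<in> Hol X U \<Longrightarrow> diff_gen X U 0 (mul_op X U g)"
| gen_add: "diff_gen X U p P \<Longrightarrow> diff_gen X U p Q \<Longrightarrow> diff_gen X U p (op_add P Q)"
| gen_fun_mult: "g \<in> Hol X U \<Longrightarrow> diff_gen X U p P \<Longrightarrow> diff_gen X U p (op_comp (mul_op X U g) P)"
| gen_vf_mult: "\<xi> \<in> vector_fields X U \<Longrightarrow> diff_gen X U p P \<Longrightarrow> diff_gen X U (Suc p) (op_comp \<xi> P)"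
| gen_mono: "diff_gen X U p P \<Longrightarrow> diff_gen X U (Suc p) P"

definition diff_ops ::
    "(complex^'N) set set \<Rightarrow> (complex^'N) set set \<Rightarrow> (complex^'N) set operator set" where
  "diff_ops X U = {P \<in> sheaf_end X U.
     \<forall>x\<in>U. \<exists>V p. openin (top_of X) V \<and> x \<in> V \<and> V \<subseteq> U \<and> diff_gen X V p (op_res V P)}"

text \<open>The order filtration \<open>F\<^sub>pD\<close>, which is zero for \<open>p < 0\<close>.\<close>

definition diff_ops_le ::
    "(complex^'N) set set \<Rightarrow> int \<Rightarrow> (complex^'N) set set \<Rightarrow> (complex^'N) set operator set" where
  "diff_ops_le X p U =
     (if p < 0 then {op_zero}
      else {P \<in> sheaf_end X U.
        \<forall>x\<in>U. \<exists>V. openin (top_of X) V \<and> x \<in> V \<and> V \<subseteq> U \<and> diff_gen X V (nat p) (op_res V P)})"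

definition DX :: "(complex^'N) set set \<Rightarrow> (complex^'N) set set \<Rightarrow> (complex^'N) set operator ring" where
  "DX X U = \<lparr>carrier = diff_ops X U, mult = op_comp, one = mul_op X U (\<lambda>x. 1),
             zero = op_zero, add = op_add\<rparr>"


section \<open>Sheaves of left modules over a sheaf of rings\<close>

text \<open>
  The library's \<^const>\<open>module\<close> locale is restricted to commutative rings; only its record type is
  used here. In the definitions below \<open>R\<close> is a presheaf of (noncommutative) rings on the
  topological space \<open>T\<close>, and \<open>\<rho> V\<close> is its restriction map to \<open>V\<close>.
\<close>

definition left_module :: "('r, 'z) ring_scheme \<Rightarrow> ('r, 'b, 'y) module_scheme \<Rightarrow> bool" where
  "left_module R M \<longleftrightarrow>
     abelian_group M \<and>
     (\<forall>r\<in>carrier R. \<forall>m\<in>carrier M. r \<odot>\<^bsub>M\<^esub> m \<in> carrier M) \<and>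
     (\<forall>r\<in>carrier R. \<forall>m\<in>carrier M. \<forall>n\<in>carrier M.
        r \<odot>\<^bsub>M\<^esub> (m \<oplus>\<^bsub>M\<^esub> n) = r \<odot>\<^bsub>M\<^esub> m \<oplus>\<^bsub>M\<^esub> r \<odot>\<^bsub>M\<^esub> n) \<and>
     (\<forall>r\<in>carrier R. \<forall>t\<in>carrier R. \<forall>m\<in>carrier M.
        (r \<oplus>\<^bsub>R\<^esub> t) \<odot>\<^bsub>M\<^esub> m = r \<odot>\<^bsub>M\<^esub> m \<oplus>\<^bsub>M\<^esub> t \<odot>\<^bsub>M\<^esub> m) \<and>
     (\<forall>r\<in>carrier R. \<forall>t\<in>carrier R. \<forall>m\<in>carrier M.
        (r \<otimes>\<^bsub>R\<^esub> t) \<odot>\<^bsub>M\<^esub> m = r \<odot>\<^bsub>M\<^esub> (t \<odot>\<^bsub>M\<^esub> m)) \<and>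
     (\<forall>m\<in>carrier M. \<one>\<^bsub>R\<^esub> \<odot>\<^bsub>M\<^esub> m = m)"

record ('x, 'r, 'b) msheaf =
  sec :: "'x set \<Rightarrow> ('r, 'b) module"
  res :: "'x set \<Rightarrow> 'x set \<Rightarrow> 'b \<Rightarrow> 'b"

definition sheaf_of_modules ::
    "'x topology \<Rightarrow> ('x set \<Rightarrow> ('r, 'z) ring_scheme) \<Rightarrow> ('x set \<Rightarrow> 'r \<Rightarrow> 'r) \<Rightarrow> ('x, 'r, 'b) msheaf \<Rightarrow> bool" where
  "sheaf_of_modules T R \<rho> F \<longleftrightarrow>
     (\<forall>U. openin T U \<longrightarrow> left_module (R U) (sec F U)) \<and>
     (\<forall>U V. openin T U \<and> openin T V \<and> V \<subseteq> U \<longrightarrow>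
        (\<forall>m\<in>carrier (sec F U). res F U V m \<in> carrier (sec F V)) \<and>
        (\<forall>m\<in>carrier (sec F U). \<forall>n\<in>carrier (sec F U).
           res F U V (m \<oplus>\<^bsub>sec F U\<^esub> n) = res F U V m \<oplus>\<^bsub>sec F V\<^esub> res F U V n) \<and>
        (\<forall>r\<in>carrier (R U). \<forall>m\<in>carrier (sec F U).
           res F U V (r \<odot>\<^bsub>sec F U\<^esub> m) = \<rho> V r \<odot>\<^bsub>sec F V\<^esub> res F U V m)) \<and>
     (\<forall>U. openin T U \<longrightarrow> (\<forall>m\<in>carrier (sec F U). res F U U m = m)) \<and>
     (\<forall>U V W. openin T U \<and> openin T V \<and> openin T W \<and> W \<subseteq> V \<and> V \<subseteq> U \<longrightarrow>
        (\<forall>m\<in>carrier (sec F U). res F V W (res F U V m) = res F U W m)) \<and>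
     (\<forall>\<U>. (\<forall>V\<in>\<U>. openin T V) \<longrightarrow>
        (\<forall>m\<in>carrier (sec F (\<Union>\<U>)). \<forall>n\<in>carrier (sec F (\<Union>\<U>)).
           (\<forall>V\<in>\<U>. res F (\<Union>\<U>) V m = res F (\<Union>\<U>) V n) \<longrightarrow> m = n) \<and>
        (\<forall>t. (\<forall>V\<in>\<U>. t V \<in> carrier (sec F V)) \<and>
             (\<forall>V\<in>\<U>. \<forall>W\<in>\<U>. res F V (V \<inter> W) (t V) = res F W (V \<inter> W) (t W)) \<longrightarrow>
             (\<exists>m\<in>carrier (sec F (\<Union>\<U>)). \<forall>V\<in>\<U>. res F (\<Union>\<U>) V m = t V)))"

definition submodule_sheaf ::
    "'x topology \<Rightarrow> ('x set \<Rightarrow> ('r, 'z) ring_scheme) \<Rightarrow> ('x, 'r, 'b) msheaf \<Rightarrow> ('x set \<Rightarrow> 'b set) \<Rightarrow> bool" where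
  "submodule_sheaf T R F N \<longleftrightarrow>
     (\<forall>U. openin T U \<longrightarrow>
        N U \<subseteq> carrier (sec F U) \<and> \<zero>\<^bsub>sec F U\<^esub> \<in> N U \<and>
        (\<forall>m\<in>N U. \<forall>n\<in>N U. m \<oplus>\<^bsub>sec F U\<^esub> n \<in> N U) \<and>
        (\<forall>r\<in>carrier (R U). \<forall>m\<in>N U. r \<odot>\<^bsub>sec F U\<^esub> m \<in> N U) \<and>
        (\<forall>V. openin T V \<and> V \<subseteq> U \<longrightarrow> res F U V ` N U \<subseteq> N V) \<and>
        (\<forall>m\<in>carrier (sec F U).
           (\<forall>x\<in>U. \<exists>V. openin T V \<and> x \<in> V \<and> V \<subseteq> U \<and> res F U V m \<in> N V) \<longrightarrow> m \<in> N U))"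

definition sub_msheaf :: "('x, 'r, 'b) msheaf \<Rightarrow> ('x set \<Rightarrow> 'b set) \<Rightarrow> ('x, 'r, 'b) msheaf" where
  "sub_msheaf F N = F\<lparr>sec := (\<lambda>U. (sec F U)\<lparr>carrier := N U\<rparr>)\<rparr>"

definition lincomb :: "('r, 'b, 'y) module_scheme \<Rightarrow> nat \<Rightarrow> (nat \<Rightarrow> 'r) \<Rightarrow> (nat \<Rightarrow> 'b) \<Rightarrow> 'b" where
  "lincomb M r c ms = (\<Oplus>\<^bsub>M\<^esub>i\<in>{..<r}. c i \<odot>\<^bsub>M\<^esub> ms i)"

text \<open>The sections \<open>ms 0, \<dots>, ms (r - 1)\<close> over \<open>U\<close> generate the restriction of \<open>F\<close> to \<open>U\<close>.\<close>

definition generated_on ::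
    "'x topology \<Rightarrow> ('x set \<Rightarrow> ('r, 'z) ring_scheme) \<Rightarrow> ('x, 'r, 'b) msheaf \<Rightarrow> 'x set \<Rightarrow> nat \<Rightarrow> (nat \<Rightarrow> 'b) \<Rightarrow> bool" where
  "generated_on T R F U r ms \<longleftrightarrow>
     (\<forall>i<r. ms i \<in> carrier (sec F U)) \<and>
     (\<forall>V y. openin T V \<and> V \<subseteq> U \<and> y \<in> V \<longrightarrow>
        (\<forall>m\<in>carrier (sec F V). \<exists>W c. openin T W \<and> y \<in> W \<and> W \<subseteq> V \<and>
           (\<forall>i<r. c i \<in> carrier (R W)) \<and>
           res F V W m = lincomb (sec F W) r c (\<lambda>i. res F U W (ms i))))"

definition is_relation ::
    "('x set \<Rightarrow> ('r, 'z) ring_scheme) \<Rightarrow> ('x, 'r, 'b) msheaf \<Rightarrow> 'x set \<Rightarrow> nat \<Rightarrow> (nat \<Rightarrow> 'b) \<Rightarrow> 'x set \<Rightarrow> (nat \<Rightarrow> 'r) \<Rightarrow> bool" where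
  "is_relation R F U r ms V c \<longleftrightarrow>
     (\<forall>i<r. c i \<in> carrier (R V)) \<and>
     lincomb (sec F V) r c (\<lambda>i. res F U V (ms i)) = \<zero>\<^bsub>sec F V\<^esub>"

text \<open>
  Coherence: locally of finite type, and for every \<open>R\<^sup>r \<rightarrow> F\<close> over an open set the kernel is
  locally of finite type.
\<close>

definition coherent ::
    "'x topology \<Rightarrow> ('x set \<Rightarrow> ('r, 'z) ring_scheme) \<Rightarrow> ('x set \<Rightarrow> 'r \<Rightarrow> 'r) \<Rightarrow> ('x, 'r, 'b) msheaf \<Rightarrow> bool" where
  "coherent T R \<rho> F \<longleftrightarrow>
     (\<forall>x\<in>topspace T. \<exists>U r ms. openin T U \<and> x \<in> U \<and> generated_on T R F U r ms) \<and>
     (\<forall>U r ms. openin T U \<and> (\<forall>i<r. ms i \<in> carrier (sec F U)) \<longrightarrow>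
        (\<forall>x\<in>U. \<exists>V (q::nat) c. openin T V \<and> x \<in> V \<and> V \<subseteq> U \<and>
           (\<forall>j<q. is_relation R F U r ms V (c j)) \<and>
           (\<forall>W b y. openin T W \<and> W \<subseteq> V \<and> y \<in> W \<and> is_relation R F U r ms W b \<longrightarrow>
              (\<exists>W' a. openin T W' \<and> y \<in> W' \<and> W' \<subseteq> W \<and> (\<forall>j<q. a j \<in> carrier (R W')) \<and>
                 (\<forall>i<r. \<rho> W' (b i) = (\<Oplus>\<^bsub>R W'\<^esub>j\<in>{..<q}. a j \<otimes>\<^bsub>R W'\<^esub> \<rho> W' (c j i)))))))"

definition zero_msheaf :: "'x topology \<Rightarrow> ('x, 'r, 'b) msheaf \<Rightarrow> bool" where
  "zero_msheaf T F \<longleftrightarrow> (\<forall>U. openin T U \<longrightarrow> carrier (sec F U) = {\<zero>\<^bsub>sec F U\<^esub>})"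


section \<open>Simple holonomic D-modules\<close>

definition DX_module ::
    "(complex^'N) set set \<Rightarrow> ((complex^'N) set, (complex^'N) set operator, 'b) msheaf \<Rightarrow> bool" where
  "DX_module X F \<longleftrightarrow> sheaf_of_modules (top_of X) (DX X) op_res F"

text \<open>
  Simplicity of a coherent D-module refers to the category of coherent D-modules. Arbitrary
  subsheaves stable under the operators must not be admitted: extending the restriction of \<open>F\<close> to
  an open set by zero gives such a subsheaf, so that no module with infinite support would be
  simple.
\<close>

definition simple_DX_module ::
    "(complex^'N) set set \<Rightarrow> ((complex^'N) set, (complex^'N) set operator, 'b) msheaf \<Rightarrow> bool" where
  "simple_DX_module X F \<longleftrightarrow>
     DX_module X F \<and> \<not> zero_msheaf (top_of X) F \<and>
     (\<forall>N. submodule_sheaf (top_of X) (DX X) F N \<and>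
          coherent (top_of X) (DX X) op_res (sub_msheaf F N) \<longrightarrow>
          zero_msheaf (top_of X) (sub_msheaf F N) \<or>
          (\<forall>U. openin (top_of X) U \<longrightarrow> N U = carrier (sec F U)))"

text \<open>
  The good filtration \<open>F\<^sub>p = \<Sum>\<^sub>i F\<^sub>pD \<cdot> ms i\<close> of \<open>F\<close> over \<open>U\<close> attached to generators \<open>ms\<close>:
  its sections over \<open>W \<subseteq> U\<close>.
\<close>

definition good_filt ::
    "(complex^'N) set set \<Rightarrow> ((complex^'N) set, (complex^'N) set operator, 'b) msheaf \<Rightarrow>
     (complex^'N) set set \<Rightarrow> nat \<Rightarrow> (nat \<Rightarrow> 'b) \<Rightarrow> int \<Rightarrow> (complex^'N) set set \<Rightarrow> 'b set" where
  "good_filt X F U r ms p W = {m \<in> carrier (sec F W).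
     \<forall>y\<in>W. \<exists>V Q. openin (top_of X) V \<and> y \<in> V \<and> V \<subseteq> W \<and> (\<forall>i<r. Q i \<in> diff_ops_le X p V) \<and>
       res F W V m = lincomb (sec F V) r Q (\<lambda>i. res F U V (ms i))}"

text \<open>
  Principal symbol of an operator \<open>P\<close> over \<open>V\<close> of order at most \<open>d\<close> at the covector \<open>d\<phi>(x)\<close>:
  if \<open>P = \<Sum> a\<^sub>\<alpha> \<partial>\<^sup>\<alpha>\<close> in coordinates then
  \<open>P ((\<phi> - \<phi>(x))\<^sup>d)(x) = d! \<Sum>\<^bsub>|\<alpha>| = d\<^esub> a\<^sub>\<alpha>(x) (d\<phi>(x))\<^sup>\<alpha>\<close>.
\<close>

definition symbol_at ::
    "(complex^'N) set set \<Rightarrow> nat \<Rightarrow> (complex^'N) set operator \<Rightarrow> (complex^'N) set \<Rightarrow>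
     ((complex^'N) set \<Rightarrow> complex) \<Rightarrow> complex" where
  "symbol_at V d P x \<phi> = P V (restr V (\<lambda>y. (\<phi> y - \<phi> x) ^ d)) x / fact d"

text \<open>
  The covector \<open>d\<phi>(x)\<close> lies in the characteristic variety, i.e. in the support of \<open>gr F\<close>, iff all
  homogeneous elements of \<open>gr D\<close> annihilating \<open>gr F\<close> near \<open>x\<close> vanish there. The result does
  not depend on the good filtration. Here \<open>\<phi>\<close> is holomorphic on the open set \<open>U\<close>.
\<close>

definition in_char_variety ::
    "(complex^'N) set set \<Rightarrow> ((complex^'N) set, (complex^'N) set operator, 'b) msheaf \<Rightarrow>
     (complex^'N) set set \<Rightarrow> (complex^'N) set \<Rightarrow> ((complex^'N) set \<Rightarrow> complex) \<Rightarrow> bool" where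
  "in_char_variety X F U x \<phi> \<longleftrightarrow>
     (\<forall>U' r ms. openin (top_of X) U' \<and> x \<in> U' \<and> U' \<subseteq> U \<and> generated_on (top_of X) (DX X) F U' r ms \<longrightarrow>
        (\<forall>V d P. openin (top_of X) V \<and> x \<in> V \<and> V \<subseteq> U' \<and> P \<in> diff_ops_le X (int d) V \<and>
           (\<forall>W p. openin (top_of X) W \<and> W \<subseteq> V \<longrightarrow>
              (\<forall>m\<in>good_filt X F U' r ms p W.
                 op_res W P \<odot>\<^bsub>sec F W\<^esub> m \<in> good_filt X F U' r ms (p + int d - 1) W)) \<longrightarrow>
           symbol_at V d P x \<phi> = 0))"

text \<open>
  The part of the characteristic variety over a chart, in the coordinates \<open>(z, \<zeta>)\<close> on the cotangent
  bundle, where \<open>\<zeta>\<close> stands for the covector \<open>\<Sum>\<^sub>i \<zeta>\<^sub>i dz\<^sub>i\<close>.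
\<close>

definition char_variety ::
    "(complex^'N) set set \<Rightarrow> ((complex^'N) set, (complex^'N) set operator, 'b) msheaf \<Rightarrow>
     'N set \<Rightarrow> (complex^'N) set set \<Rightarrow> ((complex^'N) set \<Rightarrow> complex^'N) \<Rightarrow> (complex^('N + 'N)) set" where
  "char_variety X F I U z = {w. \<exists>x\<in>U.
     (\<forall>i. w $ Inl i = z x $ i) \<and> (\<forall>i. i \<notin> I \<longrightarrow> w $ Inr i = 0) \<and>
     in_char_variety X F U x (\<lambda>y. \<Sum>i\<in>I. w $ Inr i * z y $ i)}"

text \<open>Dimension of an analytic set: the supremum of its dimensions at regular points.\<close>

definition regular_point :: "(complex^'m) set \<Rightarrow> nat \<Rightarrow> complex^'m \<Rightarrow> bool" where
  "regular_point A k a \<longleftrightarrow> a \<in> A \<and>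
     (\<exists>W W' (\<Phi> :: complex^'m \<Rightarrow> complex^'m) \<Psi> L. open W \<and> a \<in> W \<and> open W' \<and>
        holomorphic_map \<Phi> W \<and> holomorphic_map \<Psi> W' \<and> \<Phi> ` W = W' \<and>
        (\<forall>v\<in>W. \<Psi> (\<Phi> v) = v) \<and>
        vec.subspace L \<and> vec.dim L = k \<and> \<Phi> ` (A \<inter> W) = L \<inter> W')"

definition analytic_dim :: "(complex^'m) set \<Rightarrow> enat" where
  "analytic_dim A = Sup {enat k | k. \<exists>a. regular_point A k a}"

definition holonomic ::
    "(complex^'N) set set \<Rightarrow> ((complex^'N) set, (complex^'N) set operator, 'b) msheaf \<Rightarrow> bool" where
  "holonomic X F \<longleftrightarrow>
     DX_module X F \<and> coherent (top_of X) (DX X) op_res F \<and>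
     (\<forall>I U z. is_chart X I U z \<longrightarrow>
        char_variety X F I U z = {} \<or> analytic_dim (char_variety X F I U z) = enat (card I))"


section \<open>Localization along a hypersurface and the invariant omega\<close>

abbreviation fun_act ::
    "(complex^'N) set set \<Rightarrow> ((complex^'N) set, (complex^'N) set operator, 'b) msheaf \<Rightarrow>
     (complex^'N) set set \<Rightarrow> ((complex^'N) set \<Rightarrow> complex) \<Rightarrow> 'b \<Rightarrow> 'b" where
  "fun_act X F U g m \<equiv> mul_op X U g \<odot>\<^bsub>sec F U\<^esub> m"

text \<open>
  \<open>M = S\<^sub>f\<close>, the localization of \<open>S\<close> along \<open>f = 0\<close>, for \<open>S\<close> on which \<open>f\<close> acts injectively: then \<open>S\<close>
  is a D-submodule of \<open>M\<close>, \<open>f\<close> acts bijectively on \<open>M\<close>, and every section of \<open>M\<close> is locally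
  of the form \<open>f\<^sup>-\<^sup>k u\<close> with \<open>u\<close> in \<open>S\<close>. These properties determine \<open>M\<close> up to a unique isomorphism
  over \<open>S\<close>.
\<close>

definition localization_along ::
    "(complex^'N) set set \<Rightarrow> ((complex^'N) set \<Rightarrow> complex) \<Rightarrow>
     ((complex^'N) set, (complex^'N) set operator, 'b) msheaf \<Rightarrow>
     ((complex^'N) set, (complex^'N) set operator, 'b) msheaf \<Rightarrow> bool" where
  "localization_along X f S M \<longleftrightarrow>
     DX_module X M \<and>
     submodule_sheaf (top_of X) (DX X) M (\<lambda>U. carrier (sec S U)) \<and>
     S = sub_msheaf M (\<lambda>U. carrier (sec S U)) \<and>
     (\<forall>U. openin (top_of X) U \<longrightarrow>
        bij_betw (fun_act X M U f) (carrier (sec M U)) (carrier (sec M U))) \<and>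
     (\<forall>U x. openin (top_of X) U \<and> x \<in> U \<longrightarrow>
        (\<forall>m\<in>carrier (sec M U). \<exists>V k. openin (top_of X) V \<and> x \<in> V \<and> V \<subseteq> U \<and>
           fun_act X M V (\<lambda>y. f y ^ k) (res M U V m) \<in> carrier (sec S V)))"

text \<open>The polynomial ring \<open>D[s]\<close>; the variable \<open>s\<close> commutes with the coefficients.\<close>

abbreviation DXs :: "(complex^'N) set set \<Rightarrow> (complex^'N) set set \<Rightarrow>
    ((complex^'N) set operator, nat \<Rightarrow> (complex^'N) set operator) up_ring" where
  "DXs X U \<equiv> UP (DX X U)"

definition DXs_res :: "'x set \<Rightarrow> (nat \<Rightarrow> 'x operator) \<Rightarrow> nat \<Rightarrow> 'x operator" where
  "DXs_res V P = (\<lambda>j. op_res V (P j))"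

text \<open>
  The sheaf \<open>M[s] f\<^sup>s\<close>, with scalar multiplication \<open>act\<close>. A section \<open>\<Sum>\<^sub>j u\<^sub>j s\<^sup>j f\<^sup>s\<close> is encoded by its
  coefficient sequence \<open>u\<close>, which has to be finite locally. The fields \<open>mult\<close> and \<open>one\<close> are not
  used for modules.
\<close>

definition Ms_fs ::
    "(complex^'N) set set \<Rightarrow> ((complex^'N) set, (complex^'N) set operator, 'b) msheaf \<Rightarrow>
     ((complex^'N) set set \<Rightarrow> (nat \<Rightarrow> (complex^'N) set operator) \<Rightarrow> (nat \<Rightarrow> 'b) \<Rightarrow> (nat \<Rightarrow> 'b)) \<Rightarrow>
     ((complex^'N) set, nat \<Rightarrow> (complex^'N) set operator, nat \<Rightarrow> 'b) msheaf" where
  "Ms_fs X M act = \<lparr>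
     sec = (\<lambda>U. \<lparr>
       carrier = {u. (\<forall>j. u j \<in> carrier (sec M U)) \<and>
         (\<forall>x\<in>U. \<exists>V d. openin (top_of X) V \<and> x \<in> V \<and> V \<subseteq> U \<and>
            (\<forall>j>d. res M U V (u j) = \<zero>\<^bsub>sec M V\<^esub>))},
       mult = undefined, one = undefined,
       zero = (\<lambda>j. \<zero>\<^bsub>sec M U\<^esub>),
       add = (\<lambda>u v j. u j \<oplus>\<^bsub>sec M U\<^esub> v j),
       smult = act U\<rparr>),
     res = (\<lambda>U V u j. res M U V (u j))\<rparr>"

text \<open>The section \<open>m s\<^sup>j f\<^sup>s\<close>.\<close>

definition ms_term ::
    "((complex^'N) set, (complex^'N) set operator, 'b) msheaf \<Rightarrow> (complex^'N) set set \<Rightarrow> 'b \<Rightarrow> nat \<Rightarrow> nat \<Rightarrow> 'b" where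
  "ms_term M U m j = (\<lambda>i. if i = j then m else \<zero>\<^bsub>sec M U\<^esub>)"

text \<open>Division by \<open>f\<close> in the localization.\<close>

definition div_f ::
    "(complex^'N) set set \<Rightarrow> ((complex^'N) set \<Rightarrow> complex) \<Rightarrow>
     ((complex^'N) set, (complex^'N) set operator, 'b) msheaf \<Rightarrow> (complex^'N) set set \<Rightarrow> 'b \<Rightarrow> 'b" where
  "div_f X f M U m = (THE n. n \<in> carrier (sec M U) \<and> fun_act X M U f n = m)"

text \<open>
  \<open>act\<close> is the left \<open>D[s]\<close>-action on \<open>M[s] f\<^sup>s\<close>: it is determined by the given formulas because
  \<open>D[s]\<close> is locally generated by functions, vector fields and \<open>s\<close>.
\<close>

definition is_fs_action ::
    "(complex^'N) set set \<Rightarrow> ((complex^'N) set \<Rightarrow> complex) \<Rightarrow>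
     ((complex^'N) set, (complex^'N) set operator, 'b) msheaf \<Rightarrow>
     ((complex^'N) set set \<Rightarrow> (nat \<Rightarrow> (complex^'N) set operator) \<Rightarrow> (nat \<Rightarrow> 'b) \<Rightarrow> (nat \<Rightarrow> 'b)) \<Rightarrow> bool" where
  "is_fs_action X f M act \<longleftrightarrow>
     sheaf_of_modules (top_of X) (DXs X) DXs_res (Ms_fs X M act) \<and>
     (\<forall>U j. \<forall>m\<in>carrier (sec M U). openin (top_of X) U \<longrightarrow>
        act U (up_ring.monom (DXs X U) \<one>\<^bsub>DX X U\<^esub> 1) (ms_term M U m j) = ms_term M U m (Suc j) \<and>
        (\<forall>g\<in>Hol X U.
           act U (up_ring.monom (DXs X U) (mul_op X U g) 0) (ms_term M U m j)
           = ms_term M U (fun_act X M U g m) j) \<and>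
        (\<forall>\<xi>\<in>vector_fields X U.
           act U (up_ring.monom (DXs X U) \<xi> 0) (ms_term M U m j)
           = ms_term M U (\<xi> \<odot>\<^bsub>sec M U\<^esub> m) j
             \<oplus>\<^bsub>sec (Ms_fs X M act) U\<^esub>
             ms_term M U (div_f X f M U (fun_act X M U (\<xi> U (restr U f)) m)) (Suc j)))"

text \<open>The section \<open>m f\<^bsup>s+k\<^esup> = (f\<^sup>k m) f\<^sup>s\<close>, for \<open>k \<ge> 0\<close>.\<close>

definition m_fsk ::
    "(complex^'N) set set \<Rightarrow> ((complex^'N) set \<Rightarrow> complex) \<Rightarrow>
     ((complex^'N) set, (complex^'N) set operator, 'b) msheaf \<Rightarrow> (complex^'N) set set \<Rightarrow> 'b \<Rightarrow> nat \<Rightarrow> nat \<Rightarrow> 'b" where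
  "m_fsk X f M U m k = ms_term M U (fun_act X M U (\<lambda>x. f x ^ k) m) 0"

definition s_plus :: "(complex^'N) set set \<Rightarrow> (complex^'N) set set \<Rightarrow> complex \<Rightarrow> nat \<Rightarrow> (complex^'N) set operator" where
  "s_plus X U \<alpha> =
     up_ring.monom (DXs X U) \<one>\<^bsub>DX X U\<^esub> 1 \<oplus>\<^bsub>DXs X U\<^esub> up_ring.monom (DXs X U) (mul_op X U (\<lambda>x. \<alpha>)) 0"

text \<open>
  The number \<open>\<ell>\<^sub>k\<close> for a global section \<open>m\<close> of \<open>M\<close>. As usual for sections of sheaves, the existence
  of \<open>P\<close> and the congruence are understood locally on \<open>X\<close>. The minimum is taken in \<^typ>\<open>enat\<close>, so
  it is \<open>\<infinity>\<close> should no \<open>\<ell>\<close> exist.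
\<close>

definition ell ::
    "(complex^'N) set set \<Rightarrow> ((complex^'N) set \<Rightarrow> complex) \<Rightarrow>
     ((complex^'N) set, (complex^'N) set operator, 'b) msheaf \<Rightarrow>
     ((complex^'N) set set \<Rightarrow> (nat \<Rightarrow> (complex^'N) set operator) \<Rightarrow> (nat \<Rightarrow> 'b) \<Rightarrow> (nat \<Rightarrow> 'b)) \<Rightarrow>
     'b \<Rightarrow> complex \<Rightarrow> nat \<Rightarrow> enat" where
  "ell X f M act m \<alpha> k = Inf {enat l | l.
     \<forall>x\<in>X. \<exists>V. openin (top_of X) V \<and> x \<in> V \<and>
       (\<exists>P\<in>carrier (DXs X V). \<exists>q\<in>carrier (sec (Ms_fs X M act) V).
          act V P (m_fsk X f M V (res M X V m) k)
          = act V (s_plus X V \<alpha> [^]\<^bsub>DXs X V\<^esub> l) (m_fsk X f M V (res M X V m) 0)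
            \<oplus>\<^bsub>sec (Ms_fs X M act) V\<^esub>
            act V (s_plus X V \<alpha> [^]\<^bsub>DXs X V\<^esub> (l + 1)) q)}"

definition omega ::
    "(complex^'N) set set \<Rightarrow> ((complex^'N) set \<Rightarrow> complex) \<Rightarrow>
     ((complex^'N) set, (complex^'N) set operator, 'b) msheaf \<Rightarrow>
     ((complex^'N) set set \<Rightarrow> (nat \<Rightarrow> (complex^'N) set operator) \<Rightarrow> (nat \<Rightarrow> 'b) \<Rightarrow> (nat \<Rightarrow> 'b)) \<Rightarrow>
     'b \<Rightarrow> complex \<Rightarrow> enat" where
  "omega X f M act m \<alpha> = lim (\<lambda>k. ell X f M act m \<alpha> k)"

end

theory Submission
  imports Defs
begin

text \<open>
  Modulo \<open>s\<close>, the module \<open>M[s] f\<^sup>s\<close> is just \<open>M\<close>: the term by which the action of a vector field on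
  \<open>M[s] f\<^sup>s\<close> differs from its action on \<open>M\<close> is divisible by \<open>s\<close>. So the coefficient of \<open>P u\<close> at \<open>s\<^sup>0\<close> is
  the constant term of \<open>P\<close> applied to the coefficient of \<open>u\<close> at \<open>s\<^sup>0\<close> (\<open>act_0\<close>). For \<open>\<alpha> = 0\<close> it follows
  that \<open>\<ell>\<^sub>k = 0\<close> means that \<open>m \<in> D \<cdot> f\<^sup>k m\<close> locally on \<open>X\<close> (\<open>ell_eq_0_iff\<close>). The sequence \<open>\<ell>\<^sub>k\<close> is nondecreasing,
  because \<open>m f\<^bsup>s+k+1\<^esup> = f \<cdot> m f\<^bsup>s+k\<^esup>\<close>; hence \<open>\<omega> = 0\<close> iff \<open>m \<in> D \<cdot> f\<^sup>k m\<close> locally for all \<open>k\<close>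
  (\<open>omega_eq_0_iff\<close>).

  If \<open>\<omega> = 0\<close>, choose near a given point some \<open>k\<close> with \<open>f\<^sup>k m\<close> in \<open>S\<close>, which exists as \<open>M\<close> is the localization
  of \<open>S\<close>. Then \<open>m \<in> D \<cdot> f\<^sup>k m\<close> lies in \<open>S\<close> near that point, and membership in \<open>S\<close> is a local property.

  Conversely let \<open>m \<noteq> 0\<close> be in \<open>S\<close>. For each \<open>k\<close> the section \<open>f\<^sup>k m\<close> of \<open>S\<close> is nonzero, since \<open>f\<close> acts
  injectively. The submodule \<open>D \<cdot> f\<^sup>k m\<close> of \<open>S\<close> is generated by one section of a coherent module and
  therefore coherent (\<open>coherent_cyclic_sub\<close>), so by simplicity it is all of \<open>S\<close> and contains \<open>m\<close>
  (\<open>simple_generated\<close>).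

  To work with polynomials in \<open>s\<close> and with the submodule generated by a section, it has to be known
  that the differential operators over an open set form a ring (\<open>ring_DX\<close>).
\<close>


section \<open>Holomorphic functions on subsets of projective space\<close>

lemma holomorphic_fun_subset:
  assumes "holomorphic_fun g A" "B \<subseteq> A"
  shows "holomorphic_fun g B"
  using assms unfolding holomorphic_fun_def by (meson has_derivative_subset subsetD)

lemma holomorphic_fun_const: "holomorphic_fun (\<lambda>v. c) A"
  unfolding holomorphic_fun_def by (intro ballI exI[of _ "\<lambda>v. 0"]) auto

lemma holomorphic_fun_add:
  assumes "holomorphic_fun g A" "holomorphic_fun h A"
  shows "holomorphic_fun (\<lambda>v. g v + h v) A"
  unfolding holomorphic_fun_def
proof
  fix a assume "a \<in> A"
  then obtain D E where
    "(g has_derivative D) (at a within A)" "\<And>c v. D (c *s v) = c * D v"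
    "(h has_derivative E) (at a within A)" "\<And>c v. E (c *s v) = c * E v"
    using assms unfolding holomorphic_fun_def by metis
  then show "\<exists>F. ((\<lambda>v. g v + h v) has_derivative F) (at a within A) \<and> (\<forall>c v. F (c *s v) = c * F v)"
    by (intro exI[of _ "\<lambda>v. D v + E v"]) (auto intro: has_derivative_add simp: algebra_simps)
qed

lemma holomorphic_fun_mult:
  assumes "holomorphic_fun g A" "holomorphic_fun h A"
  shows "holomorphic_fun (\<lambda>v. g v * h v) A"
  unfolding holomorphic_fun_def
proof
  fix a assume "a \<in> A"
  then obtain D E where
    "(g has_derivative D) (at a within A)" "\<And>c v. D (c *s v) = c * D v"
    "(h has_derivative E) (at a within A)" "\<And>c v. E (c *s v) = c * E v"
    using assms unfolding holomorphic_fun_def by metis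
  then show "\<exists>F. ((\<lambda>v. g v * h v) has_derivative F) (at a within A) \<and> (\<forall>c v. F (c *s v) = c * F v)"
    by (intro exI[of _ "\<lambda>v. g a * E v + D v * h a"] conjI has_derivative_mult)
      (simp_all add: algebra_simps)
qed

lemma cone_over_mono: "U \<subseteq> V \<Longrightarrow> cone_over U \<subseteq> cone_over V"
  by (auto simp: cone_over_def)

lemma openin_proj_space: "openin proj_topology (proj_space :: (complex^'N) set set)"
proof -
  have "cone_over proj_space = - {0 :: complex^'N}"
    by (auto simp: cone_over_def proj_space_def)
  then show ?thesis by (simp add: openin_proj_topology open_Compl)
qed

lemma Hol_outside: "g \<in> Hol X U \<Longrightarrow> x \<notin> U \<Longrightarrow> g x = 0"
  by (simp add: Hol_def)

lemma Hol_restr: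
  assumes "g \<in> Hol X U" "V \<subseteq> U"
  shows "restr V g \<in> Hol X V"
  unfolding Hol_def
proof (intro CollectI conjI ballI allI impI)
  fix x assume "x \<in> V"
  then have "x \<in> U" using assms by blast
  then obtain W G where "openin proj_topology W" "x \<in> W"
    "holomorphic_fun (\<lambda>v. G (proj_pt v)) (cone_over W)" "\<forall>y\<in>U \<inter> W. g y = G y"
    using assms(1) unfolding Hol_def by blast
  then show "\<exists>W G. openin proj_topology W \<and> x \<in> W \<and>
      holomorphic_fun (\<lambda>v. G (proj_pt v)) (cone_over W) \<and> (\<forall>y\<in>V \<inter> W. restr V g y = G y)"
    using assms(2) by (intro exI[of _ W] exI[of _ G]) (auto simp: restr_def)
qed (simp add: restr_def)

lemma Hol_const:
  assumes "U \<subseteq> proj_space"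
  shows "restr U (\<lambda>x. c) \<in> Hol X U"
  unfolding Hol_def
proof (intro CollectI conjI ballI allI impI)
  fix x assume "x \<in> U"
  then show "\<exists>W G. openin proj_topology W \<and> x \<in> W \<and>
      holomorphic_fun (\<lambda>v. G (proj_pt v)) (cone_over W) \<and> (\<forall>y\<in>U \<inter> W. restr U (\<lambda>x. c) y = G y)"
    using assms openin_proj_space holomorphic_fun_const
    by (intro exI[of _ proj_space] exI[of _ "\<lambda>x. c"]) (auto simp: restr_def)
qed (simp add: restr_def)

text \<open>
  Sums and products are treated together: both are holomorphic in the two values and take
  \<open>(0, 0)\<close> to \<open>0\<close>, so that the normalisation of sections to be zero outside \<open>U\<close> survives.
\<close>

lemma Hol_pointwise:
  fixes b :: "complex \<Rightarrow> complex \<Rightarrow> complex"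
  assumes b: "\<And>A (g :: complex^'N \<Rightarrow> complex) h.
      holomorphic_fun g A \<Longrightarrow> holomorphic_fun h A \<Longrightarrow> holomorphic_fun (\<lambda>v. b (g v) (h v)) A"
    and "b 0 0 = 0"
    and g: "g \<in> Hol (X :: (complex^'N) set set) U" and h: "h \<in> Hol X U"
  shows "(\<lambda>x. b (g x) (h x)) \<in> Hol X U"
  unfolding Hol_def
proof (intro CollectI conjI ballI allI impI)
  fix x assume "x \<in> U"
  then obtain W G W' G' where
    "openin proj_topology W" "x \<in> W"
    and G: "holomorphic_fun (\<lambda>v. G (proj_pt v)) (cone_over W)" "\<forall>y\<in>U \<inter> W. g y = G y"
    and "openin proj_topology W'" "x \<in> W'"
    and G': "holomorphic_fun (\<lambda>v. G' (proj_pt v)) (cone_over W')" "\<forall>y\<in>U \<inter> W'. h y = G' y"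
    using g h unfolding Hol_def by blast
  moreover have "holomorphic_fun (\<lambda>v. b (G (proj_pt v)) (G' (proj_pt v))) (cone_over (W \<inter> W'))"
    by (intro b holomorphic_fun_subset[OF G(1)] holomorphic_fun_subset[OF G'(1)] cone_over_mono) auto
  ultimately show "\<exists>W G. openin proj_topology W \<and> x \<in> W \<and>
      holomorphic_fun (\<lambda>v. G (proj_pt v)) (cone_over W) \<and> (\<forall>y\<in>U \<inter> W. b (g y) (h y) = G y)"
    by (intro exI[of _ "W \<inter> W'"] exI[of _ "\<lambda>y. b (G y) (G' y)"]) auto
qed (use assms in \<open>simp add: Hol_outside\<close>)

lemma Hol_add: "g \<in> Hol X U \<Longrightarrow> h \<in> Hol X U \<Longrightarrow> (\<lambda>x. g x + h x) \<in> Hol X U"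
  by (rule Hol_pointwise[where b = "(+)"]) (auto intro: holomorphic_fun_add)

lemma Hol_mult: "g \<in> Hol X U \<Longrightarrow> h \<in> Hol X U \<Longrightarrow> (\<lambda>x. g x * h x) \<in> Hol X U"
  by (rule Hol_pointwise[where b = "(*)"]) (auto intro: holomorphic_fun_mult)


section \<open>Differential operators form a ring\<close>

text \<open>
  An operator over \<open>U\<close> is applied only to functions that vanish outside \<open>U\<close>, so the values of a
  multiplier there are irrelevant. This lets \<open>1\<close> and the powers of a global function, which do not
  satisfy the normalisation of sections over \<open>U\<close>, serve as multipliers over \<open>U\<close>.
\<close>

lemma mul_op_cong: "(\<And>x. x \<in> U \<Longrightarrow> g x = h x) \<Longrightarrow> mul_op X U g = mul_op X U h"
  unfolding mul_op_def by (intro ext if_cong refl) (metis Hol_outside mult_zero_right subsetD)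

lemma mul_op_restr: "mul_op X U (restr U g) = mul_op X U g"
  by (rule mul_op_cong) (simp add: restr_def)

locale projective_set =
  fixes X :: "(complex^'N) set set"
  assumes in_proj_space: "X \<subseteq> proj_space"
begin

lemma openin_self: "openin (top_of X) X"
  using openin_proj_space in_proj_space by (auto simp: openin_subtopology)

lemma openin_in_proj_space: "openin (top_of X) U \<Longrightarrow> U \<subseteq> proj_space"
  using in_proj_space by (auto simp: openin_subtopology)

lemma openin_sub: "openin (top_of X) U \<Longrightarrow> U \<subseteq> X"
  by (auto simp: openin_subtopology)

lemma Hol_scale: "openin (top_of X) U \<Longrightarrow> g \<in> Hol X U \<Longrightarrow> (\<lambda>x. c * g x) \<in> Hol X U"
proof -
  assume U: "openin (top_of X) U" and g: "g \<in> Hol X U"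
  have "(\<lambda>x. c * g x) = (\<lambda>x. restr U (\<lambda>x. c) x * g x)"
    using g by (auto simp: restr_def Hol_outside)
  then show ?thesis
    using Hol_mult[OF Hol_const g] openin_in_proj_space[OF U] by simp
qed

lemma Hol_power: "f \<in> Hol X X \<Longrightarrow> openin (top_of X) U \<Longrightarrow> restr U (\<lambda>x. f x ^ k) \<in> Hol X U"
proof (induction k)
  case 0
  then show ?case by (simp add: Hol_const openin_in_proj_space)
next
  case (Suc k)
  have "restr U (\<lambda>x. f x ^ Suc k) = (\<lambda>x. restr U f x * restr U (\<lambda>x. f x ^ k) x)"
    by (auto simp: restr_def)
  then show ?case
    using Hol_mult[OF Hol_restr[OF Suc.prems(1) openin_sub[OF Suc.prems(2)]] Suc.IH[OF Suc.prems]]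
    by simp
qed

lemma sheaf_end_apply:
  assumes "P \<in> sheaf_end X U" "openin (top_of X) V" "V \<subseteq> U" "g \<in> Hol X V"
  shows "P V g \<in> Hol X V"
    and "h \<in> Hol X V \<Longrightarrow> P V (\<lambda>x. g x + h x) = (\<lambda>x. P V g x + P V h x)"
    and "P V (\<lambda>x. c * g x) = (\<lambda>x. c * P V g x)"
    and "openin (top_of X) W \<Longrightarrow> W \<subseteq> V \<Longrightarrow> P W (restr W g) = restr W (P V g)"
proof -
  have *: "(\<forall>g\<in>Hol X V. P V g \<in> Hol X V) \<and>
        (\<forall>g\<in>Hol X V. \<forall>h\<in>Hol X V. P V (\<lambda>x. g x + h x) = (\<lambda>x. P V g x + P V h x)) \<and>
        (\<forall>c. \<forall>g\<in>Hol X V. P V (\<lambda>x. c * g x) = (\<lambda>x. c * P V g x)) \<and>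
        (\<forall>W. \<forall>g\<in>Hol X V. openin (top_of X) W \<and> W \<subseteq> V \<longrightarrow> P W (restr W g) = restr W (P V g))"
    using conjunct1[OF assms(1)[unfolded sheaf_end_def mem_Collect_eq], rule_format, OF conjI[OF assms(2,3)]]
    by (intro conjI) (elim conjE; assumption)+
  show "P V g \<in> Hol X V"
    using * assms(4) by (elim conjE) (drule bspec, assumption+)
  show "P V (\<lambda>x. g x + h x) = (\<lambda>x. P V g x + P V h x)" if "h \<in> Hol X V"
    using * assms(4) that by (elim conjE) (drule bspec, assumption, drule bspec, assumption+)
  show "P V (\<lambda>x. c * g x) = (\<lambda>x. c * P V g x)"
    using * assms(4) by (elim conjE) (drule spec[of _ c], drule bspec, assumption+)
  show "P W (restr W g) = restr W (P V g)" if "openin (top_of X) W" "W \<subseteq> V"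
    using * assms(4) that by (elim conjE) (drule spec[of _ W], drule bspec, assumption, drule mp, auto)
qed

lemma sheaf_end_undefined:
  assumes "P \<in> sheaf_end X U" "\<not> (openin (top_of X) V \<and> V \<subseteq> U \<and> g \<in> Hol X V)"
  shows "P V g = (\<lambda>x. 0)"
  using conjunct2[OF assms(1)[unfolded sheaf_end_def mem_Collect_eq]] assms(2) by simp

lemma sheaf_endI:
  assumes "\<And>V g. openin (top_of X) V \<Longrightarrow> V \<subseteq> U \<Longrightarrow> g \<in> Hol X V \<Longrightarrow> P V g \<in> Hol X V"
    and "\<And>V g h. openin (top_of X) V \<Longrightarrow> V \<subseteq> U \<Longrightarrow> g \<in> Hol X V \<Longrightarrow> h \<in> Hol X V \<Longrightarrow>
           P V (\<lambda>x. g x + h x) = (\<lambda>x. P V g x + P V h x)"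
    and "\<And>V g c. openin (top_of X) V \<Longrightarrow> V \<subseteq> U \<Longrightarrow> g \<in> Hol X V \<Longrightarrow>
           P V (\<lambda>x. c * g x) = (\<lambda>x. c * P V g x)"
    and "\<And>V W g. openin (top_of X) V \<Longrightarrow> V \<subseteq> U \<Longrightarrow> openin (top_of X) W \<Longrightarrow> W \<subseteq> V \<Longrightarrow>
           g \<in> Hol X V \<Longrightarrow> P W (restr W g) = restr W (P V g)"
    and "\<And>V g. \<not> (openin (top_of X) V \<and> V \<subseteq> U \<and> g \<in> Hol X V) \<Longrightarrow> P V g = (\<lambda>x. 0)"
  shows "P \<in> sheaf_end X U"
  unfolding sheaf_end_def mem_Collect_eq
  by (intro conjI allI ballI impI; (elim conjE)?; rule assms; (assumption | simp))

lemma sheaf_end_zero: "P \<in> sheaf_end X U \<Longrightarrow> P V (\<lambda>x. 0) = (\<lambda>x. 0)"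
  using sheaf_end_apply(3)[of P U V "\<lambda>x. 0" 0] sheaf_end_undefined[of P U V "\<lambda>x. 0"]
  by (cases "openin (top_of X) V \<and> V \<subseteq> U \<and> (\<lambda>x. 0) \<in> Hol X V") simp_all

lemma mul_op_sheaf_end:
  assumes "g \<in> Hol X U"
  shows "mul_op X U g \<in> sheaf_end X U"
proof (rule sheaf_endI)
  fix V h assume V: "openin (top_of X) V" "V \<subseteq> U" and h: "h \<in> Hol X V"
  have eq: "mul_op X U g V h = (\<lambda>x. restr V g x * h x)"
    using V h by (auto simp: mul_op_def restr_def Hol_outside fun_eq_iff)
  show "mul_op X U g V h \<in> Hol X V"
    unfolding eq by (rule Hol_mult[OF Hol_restr[OF assms V(2)] h])
  show "mul_op X U g V (\<lambda>x. h x + h' x) = (\<lambda>x. mul_op X U g V h x + mul_op X U g V h' x)"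
    if "h' \<in> Hol X V" for h'
    using V h that Hol_add[OF h that] by (simp add: mul_op_def algebra_simps)
  show "mul_op X U g V (\<lambda>x. c * h x) = (\<lambda>x. c * mul_op X U g V h x)" for c
    using V h Hol_scale[OF V(1) h] by (simp add: mul_op_def algebra_simps)
  show "mul_op X U g W (restr W h) = restr W (mul_op X U g V h)"
    if "openin (top_of X) W" "W \<subseteq> V" for W
    using V h that Hol_restr[OF h that(2)] subset_trans[OF that(2) V(2)]
    by (simp add: mul_op_def restr_def fun_eq_iff)
qed (auto simp: mul_op_def fun_eq_iff)

lemma op_add_sheaf_end:
  assumes P: "P \<in> sheaf_end X U" and Q: "Q \<in> sheaf_end X U"
  shows "op_add P Q \<in> sheaf_end X U"
proof (rule sheaf_endI)
  fix V g assume V: "openin (top_of X) V" "V \<subseteq> U" and g: "g \<in> Hol X V"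
  note PV = sheaf_end_apply[OF P V g] and QV = sheaf_end_apply[OF Q V g]
  show "op_add P Q V g \<in> Hol X V" unfolding op_add_def by (rule Hol_add[OF PV(1) QV(1)])
  show "op_add P Q V (\<lambda>x. g x + h x) = (\<lambda>x. op_add P Q V g x + op_add P Q V h x)"
    if "h \<in> Hol X V" for h
    using PV(2)[OF that] QV(2)[OF that] by (simp add: op_add_def algebra_simps)
  show "op_add P Q V (\<lambda>x. c * g x) = (\<lambda>x. c * op_add P Q V g x)" for c
    using PV(3) QV(3) by (simp add: op_add_def algebra_simps)
  show "op_add P Q W (restr W g) = restr W (op_add P Q V g)"
    if "openin (top_of X) W" "W \<subseteq> V" for W
    using PV(4)[OF that] QV(4)[OF that] by (auto simp: op_add_def restr_def)
qed (use P Q in \<open>simp add: op_add_def sheaf_end_undefined\<close>)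

lemma op_comp_sheaf_end:
  assumes P: "P \<in> sheaf_end X U" and Q: "Q \<in> sheaf_end X U"
  shows "op_comp P Q \<in> sheaf_end X U"
proof (rule sheaf_endI)
  fix V g assume V: "openin (top_of X) V" "V \<subseteq> U" and g: "g \<in> Hol X V"
  note QV = sheaf_end_apply[OF Q V g] and PV = sheaf_end_apply[OF P V sheaf_end_apply(1)[OF Q V g]]
  show "op_comp P Q V g \<in> Hol X V" unfolding op_comp_def by (rule PV(1))
  show "op_comp P Q V (\<lambda>x. g x + h x) = (\<lambda>x. op_comp P Q V g x + op_comp P Q V h x)"
    if "h \<in> Hol X V" for h
    using QV(2)[OF that] PV(2)[OF sheaf_end_apply(1)[OF Q V that]] by (simp add: op_comp_def)
  show "op_comp P Q V (\<lambda>x. c * g x) = (\<lambda>x. c * op_comp P Q V g x)" for c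
    using PV(3) QV(3) by (simp add: op_comp_def)
  show "op_comp P Q W (restr W g) = restr W (op_comp P Q V g)"
    if "openin (top_of X) W" "W \<subseteq> V" for W
    using PV(4)[OF that] QV(4)[OF that] by (simp add: op_comp_def)
qed (use P Q in \<open>simp add: op_comp_def sheaf_end_undefined sheaf_end_zero\<close>)

lemma op_res_sheaf_end:
  assumes P: "P \<in> sheaf_end X U" and "V \<subseteq> U"
  shows "op_res V P \<in> sheaf_end X V"
proof (rule sheaf_endI)
  fix V' g assume V: "openin (top_of X) V'" "V' \<subseteq> V" and g: "g \<in> Hol X V'"
  then have V': "V' \<subseteq> U" using assms by blast
  note PV = sheaf_end_apply[OF P V(1) V' g]
  show "op_res V P V' g \<in> Hol X V'" using PV(1) V by (simp add: op_res_def)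
  show "op_res V P V' (\<lambda>x. g x + h x) = (\<lambda>x. op_res V P V' g x + op_res V P V' h x)"
    if "h \<in> Hol X V'" for h
    using PV(2)[OF that] V by (simp add: op_res_def)
  show "op_res V P V' (\<lambda>x. c * g x) = (\<lambda>x. c * op_res V P V' g x)" for c
    using PV(3) V by (simp add: op_res_def)
  show "op_res V P W (restr W g) = restr W (op_res V P V' g)"
    if "openin (top_of X) W" "W \<subseteq> V'" for W
    using PV(4)[OF that] V that by (auto simp: op_res_def)
qed (use P assms in \<open>auto simp: op_res_def intro: sheaf_end_undefined\<close>)

lemma op_res_self: "P \<in> sheaf_end X U \<Longrightarrow> op_res U P = P"
  by (auto simp: op_res_def fun_eq_iff sheaf_end_undefined)

lemma mul_op_one_comp:
  assumes "P \<in> sheaf_end X U"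
  shows "op_comp (mul_op X U (\<lambda>x. 1)) P = P" "op_comp P (mul_op X U (\<lambda>x. 1)) = P"
proof -
  show "op_comp (mul_op X U (\<lambda>x. 1)) P = P"
  proof (intro ext)
    fix V g x
    show "op_comp (mul_op X U (\<lambda>x. 1)) P V g x = P V g x"
      using sheaf_end_apply(1)[OF assms, of V g] sheaf_end_undefined[OF assms, of V g]
      by (cases "openin (top_of X) V \<and> V \<subseteq> U \<and> g \<in> Hol X V") (simp_all add: op_comp_def mul_op_def)
  qed
  have "P V (mul_op X U (\<lambda>x. 1) V g) = P V g" for V g
  proof (cases "openin (top_of X) V \<and> V \<subseteq> U \<and> g \<in> Hol X V")
    case False
    then have "mul_op X U (\<lambda>x. 1) V g = (\<lambda>x. 0)" unfolding mul_op_def by (intro ext) (rule if_not_P)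
    then show ?thesis using sheaf_end_zero[OF assms] sheaf_end_undefined[OF assms False] by simp
  qed (simp add: mul_op_def)
  then show "op_comp P (mul_op X U (\<lambda>x. 1)) = P" by (simp add: op_comp_def)
qed

lemma mul_op_zero: "mul_op X U (\<lambda>x. 0) = op_zero"
  by (simp add: mul_op_def op_zero_def cong: if_cong)

lemma diff_gen_sheaf_end: "diff_gen X U p P \<Longrightarrow> P \<in> sheaf_end X U"
proof (induction rule: diff_gen.induct)
  case (gen_vf_mult \<xi> p P)
  then show ?case by (intro op_comp_sheaf_end) (auto simp: vector_fields_def)
qed (auto intro: mul_op_sheaf_end op_add_sheaf_end op_comp_sheaf_end)

lemma op_res_mul_op: "V \<subseteq> U \<Longrightarrow> op_res V (mul_op X U g) = mul_op X V (restr V g)"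
proof -
  assume "V \<subseteq> U"
  then have "op_res V (mul_op X U g) = mul_op X V g"
    by (auto simp: op_res_def mul_op_def fun_eq_iff)
  then show ?thesis by (simp add: mul_op_restr)
qed

lemma op_res_op_add: "op_res V (op_add P Q) = op_add (op_res V P) (op_res V Q)"
  by (auto simp: op_res_def op_add_def fun_eq_iff)

lemma op_res_op_comp: "op_res V (op_comp P Q) = op_comp (op_res V P) (op_res V Q)"
  by (auto simp: op_res_def op_comp_def fun_eq_iff)

lemma op_res_op_res: "W \<subseteq> V \<Longrightarrow> op_res W (op_res V P) = op_res W P"
  by (auto simp: op_res_def fun_eq_iff)

lemma op_res_op_zero: "op_res V op_zero = op_zero"
  by (auto simp: op_res_def op_zero_def fun_eq_iff)

lemma vector_fields_res:
  assumes "\<xi> \<in> vector_fields X U" "V \<subseteq> U"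
  shows "op_res V \<xi> \<in> vector_fields X V"
proof -
  have "op_res V \<xi> \<in> sheaf_end X V"
    using assms op_res_sheaf_end by (auto simp: vector_fields_def)
  moreover have "op_res V \<xi> W (\<lambda>x. g x * h x) = (\<lambda>x. op_res V \<xi> W g x * h x + g x * op_res V \<xi> W h x)"
    if W: "openin (top_of X) W" "W \<subseteq> V" and "g \<in> Hol X W" "h \<in> Hol X W" for W g h
  proof -
    have "W \<subseteq> U" using W assms by blast
    then show ?thesis using assms that by (auto simp: vector_fields_def op_res_def)
  qed
  ultimately show ?thesis by (simp add: vector_fields_def)
qed

lemma diff_gen_res: "diff_gen X U p P \<Longrightarrow> V \<subseteq> U \<Longrightarrow> diff_gen X V p (op_res V P)"
proof (induction rule: diff_gen.induct)
  case (gen_fun_mult g p P)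
  then show ?case
    by (auto simp: op_res_op_comp op_res_mul_op intro: diff_gen.gen_fun_mult Hol_restr)
qed (auto simp: op_res_op_comp op_res_mul_op op_res_op_add
       intro: diff_gen.intros Hol_restr vector_fields_res)

lemma diff_gen_mono: "diff_gen X U p P \<Longrightarrow> p \<le> q \<Longrightarrow> diff_gen X U q P"
  by (induction q) (auto simp: le_Suc_eq intro: gen_mono)

text \<open>
  Induction on the left factor: composition distributes over sums on its left by definition, and
  a generator in front of the left factor is also in front of the composite.
\<close>

lemma diff_gen_comp: "diff_gen X U p P \<Longrightarrow> diff_gen X U q Q \<Longrightarrow> diff_gen X U (p + q) (op_comp P Q)"
proof (induction rule: diff_gen.induct)
  case (gen_add p P P')
  moreover have "op_comp (op_add P P') Q = op_add (op_comp P Q) (op_comp P' Q)"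
    by (simp add: op_comp_def op_add_def)
  ultimately show ?case by (simp add: diff_gen.gen_add)
next
  case (gen_fun_mult g p P)
  moreover have "op_comp (op_comp (mul_op X U g) P) Q = op_comp (mul_op X U g) (op_comp P Q)"
    by (simp add: op_comp_def)
  ultimately show ?case by (simp add: diff_gen.gen_fun_mult)
next
  case (gen_vf_mult \<xi> p P)
  moreover have "op_comp (op_comp \<xi> P) Q = op_comp \<xi> (op_comp P Q)"
    by (simp add: op_comp_def)
  ultimately show ?case by (simp add: diff_gen.gen_vf_mult)
qed (auto intro: diff_gen.intros)

text \<open>
  Two operators are each generated near a point, but on different neighbourhoods and with
  different orders; the intersection and the larger order serve for both.
\<close>

lemma diff_ops_common:
  assumes "P \<in> diff_ops X U" "Q \<in> diff_ops X U" "x \<in> U"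
  obtains V p where "openin (top_of X) V" "x \<in> V" "V \<subseteq> U"
    "diff_gen X V p (op_res V P)" "diff_gen X V p (op_res V Q)"
proof -
  obtain V p where V: "openin (top_of X) V" "x \<in> V" "V \<subseteq> U" "diff_gen X V p (op_res V P)"
    using assms unfolding diff_ops_def by blast
  obtain W q where W: "openin (top_of X) W" "x \<in> W" "W \<subseteq> U" "diff_gen X W q (op_res W Q)"
    using assms unfolding diff_ops_def by blast
  have "diff_gen X (V \<inter> W) p (op_res (V \<inter> W) P)" "diff_gen X (V \<inter> W) q (op_res (V \<inter> W) Q)"
    using diff_gen_res[OF V(4), of "V \<inter> W"] diff_gen_res[OF W(4), of "V \<inter> W"]
    by (simp_all add: op_res_op_res)
  then have "diff_gen X (V \<inter> W) (max p q) (op_res (V \<inter> W) P)"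
    "diff_gen X (V \<inter> W) (max p q) (op_res (V \<inter> W) Q)"
    by (auto intro: diff_gen_mono)
  then show ?thesis using that V W by (metis IntI openin_Int le_infI1)
qed

lemma diff_ops_add:
  assumes "P \<in> diff_ops X U" "Q \<in> diff_ops X U"
  shows "op_add P Q \<in> diff_ops X U"
proof -
  have "\<exists>V p. openin (top_of X) V \<and> x \<in> V \<and> V \<subseteq> U \<and> diff_gen X V p (op_res V (op_add P Q))"
    if x: "x \<in> U" for x
  proof -
    obtain V p where "openin (top_of X) V" "x \<in> V" "V \<subseteq> U"
      "diff_gen X V p (op_res V P)" "diff_gen X V p (op_res V Q)"
      using diff_ops_common[OF assms x] .
    then show ?thesis by (auto simp: op_res_op_add intro: gen_add)
  qed
  then show ?thesis using assms op_add_sheaf_end unfolding diff_ops_def by auto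
qed

lemma diff_ops_comp:
  assumes "P \<in> diff_ops X U" "Q \<in> diff_ops X U"
  shows "op_comp P Q \<in> diff_ops X U"
proof -
  have "\<exists>V p. openin (top_of X) V \<and> x \<in> V \<and> V \<subseteq> U \<and> diff_gen X V p (op_res V (op_comp P Q))"
    if x: "x \<in> U" for x
  proof -
    obtain V p where "openin (top_of X) V" "x \<in> V" "V \<subseteq> U"
      "diff_gen X V p (op_res V P)" "diff_gen X V p (op_res V Q)"
      using diff_ops_common[OF assms x] .
    then show ?thesis by (auto simp: op_res_op_comp intro: diff_gen_comp)
  qed
  then show ?thesis using assms op_comp_sheaf_end unfolding diff_ops_def by auto
qed

lemma diff_gen_diff_ops: "openin (top_of X) U \<Longrightarrow> diff_gen X U p P \<Longrightarrow> P \<in> diff_ops X U"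
  using diff_gen_sheaf_end op_res_self unfolding diff_ops_def by fastforce

lemma mul_op_diff_ops:
  "openin (top_of X) U \<Longrightarrow> restr U g \<in> Hol X U \<Longrightarrow> mul_op X U g \<in> diff_ops X U"
  using diff_gen_diff_ops[OF _ gen_fun] mul_op_restr by metis

lemma vector_fields_diff_ops:
  assumes "openin (top_of X) U" "\<xi> \<in> vector_fields X U"
  shows "\<xi> \<in> diff_ops X U"
proof -
  have "diff_gen X U 0 (mul_op X U (\<lambda>x. 1))"
    using gen_fun[OF Hol_const[OF openin_in_proj_space[OF assms(1)]]] by (simp add: mul_op_restr)
  then have "diff_gen X U 1 (op_comp \<xi> (mul_op X U (\<lambda>x. 1)))"
    using assms gen_vf_mult by fastforce
  then show ?thesis
    using assms mul_op_one_comp(2) diff_gen_diff_ops by (auto simp: vector_fields_def)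
qed

lemma diff_ops_res:
  assumes "P \<in> diff_ops X U" "openin (top_of X) V" "V \<subseteq> U"
  shows "op_res V P \<in> diff_ops X V"
proof -
  have "\<exists>W p. openin (top_of X) W \<and> x \<in> W \<and> W \<subseteq> V \<and> diff_gen X W p (op_res W (op_res V P))"
    if x: "x \<in> V" for x
  proof -
    obtain W p where W: "openin (top_of X) W" "x \<in> W" "W \<subseteq> U" "diff_gen X W p (op_res W P)"
      using assms x unfolding diff_ops_def by blast
    have "diff_gen X (V \<inter> W) p (op_res (V \<inter> W) (op_res V P))"
      using diff_gen_res[OF W(4), of "V \<inter> W"] by (simp add: op_res_op_res)
    then show ?thesis using W x assms(2) by (metis IntI openin_Int inf_le1)
  qed
  then show ?thesis using assms op_res_sheaf_end unfolding diff_ops_def by auto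
qed

text \<open>
  Distributivity \<open>(P + Q) R = P R + Q R\<close> holds by the definition of sums, whereas
  \<open>R (P + Q) = R P + R Q\<close> comes from the additivity of \<open>R\<close> on sections. Negatives are composites with multiplication
  by \<open>-1\<close>.
\<close>

lemma ring_DX:
  assumes U: "openin (top_of X) U"
  shows "ring (DX X U)"
proof -
  have const: "mul_op X U (\<lambda>x. c) \<in> diff_ops X U" for c
    using U Hol_const[OF openin_in_proj_space[OF U]] by (intro mul_op_diff_ops)
  have se: "P \<in> sheaf_end X U" if "P \<in> diff_ops X U" for P
    using that by (simp add: diff_ops_def)
  have "abelian_group (DX X U)"
  proof (rule abelian_groupI)
    fix P assume "P \<in> carrier (DX X U)"
    then have P: "P \<in> diff_ops X U" by (simp add: DX_def)
    have "op_add (op_comp (mul_op X U (\<lambda>x. - 1)) P) P = op_zero"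
    proof (intro ext)
      fix V g x
      show "op_add (op_comp (mul_op X U (\<lambda>x. - 1)) P) P V g x = op_zero V g x"
        using sheaf_end_apply(1)[OF se[OF P], of V g] sheaf_end_undefined[OF se[OF P], of V g]
        by (cases "openin (top_of X) V \<and> V \<subseteq> U \<and> g \<in> Hol X V")
          (simp_all add: op_add_def op_comp_def mul_op_def op_zero_def)
    qed
    then show "\<exists>Q\<in>carrier (DX X U). Q \<oplus>\<^bsub>DX X U\<^esub> P = \<zero>\<^bsub>DX X U\<^esub>"
      using diff_ops_comp[OF const P] by (auto simp: DX_def)
  next
    fix P Q assume "P \<in> carrier (DX X U)" "Q \<in> carrier (DX X U)"
    then show "P \<oplus>\<^bsub>DX X U\<^esub> Q \<in> carrier (DX X U)" by (simp add: DX_def diff_ops_add)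
  next
    show "\<zero>\<^bsub>DX X U\<^esub> \<in> carrier (DX X U)" using const[of 0] by (simp add: DX_def mul_op_zero)
  qed (simp_all add: DX_def op_add_def op_zero_def algebra_simps)
  moreover have "monoid (DX X U)"
  proof
    show "(P \<otimes>\<^bsub>DX X U\<^esub> Q) \<otimes>\<^bsub>DX X U\<^esub> R = P \<otimes>\<^bsub>DX X U\<^esub> (Q \<otimes>\<^bsub>DX X U\<^esub> R)" for P Q R
      by (simp add: DX_def op_comp_def)
  qed (use const[of 1] in \<open>auto simp: DX_def diff_ops_comp mul_op_one_comp se\<close>)
  moreover have "op_comp R (op_add P Q) = op_add (op_comp R P) (op_comp R Q)"
    if "P \<in> diff_ops X U" "Q \<in> diff_ops X U" "R \<in> diff_ops X U" for P Q R
  proof -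
    have "R V (\<lambda>x. P V g x + Q V g x) = (\<lambda>x. R V (P V g) x + R V (Q V g) x)" for V g
    proof (cases "openin (top_of X) V \<and> V \<subseteq> U \<and> g \<in> Hol X V")
      case True
      then show ?thesis
        using sheaf_end_apply(2)[OF se[OF that(3)]] sheaf_end_apply(1)[OF se] that by blast
    next
      case False
      then show ?thesis
        using sheaf_end_undefined[OF se[OF that(1)] False] sheaf_end_undefined[OF se[OF that(2)] False]
          sheaf_end_zero[OF se[OF that(3)]] by simp
    qed
    then show ?thesis by (simp add: op_comp_def op_add_def fun_eq_iff)
  qed
  ultimately show ?thesis
    by (intro ringI) (auto simp: DX_def op_comp_def op_add_def)
qed

end


section \<open>Sheaves of modules over a presheaf of rings\<close>

text \<open>
  The same setting is used for the operators acting on \<open>S\<close> and \<open>M\<close> and for the polynomials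
  in \<open>s\<close> acting on \<open>M[s] f\<^sup>s\<close>.
\<close>

locale module_sheaf =
  fixes T :: "'x topology"
    and R :: "'x set \<Rightarrow> ('r, 'z) ring_scheme"
    and \<rho> :: "'x set \<Rightarrow> 'r \<Rightarrow> 'r"
    and F :: "('x, 'r, 'b) msheaf"
  assumes sheaf: "sheaf_of_modules T R \<rho> F"
    and ring_R: "openin T U \<Longrightarrow> ring (R U)"
    and scalar_res: "openin T U \<Longrightarrow> openin T V \<Longrightarrow> V \<subseteq> U \<Longrightarrow> r \<in> carrier (R U) \<Longrightarrow> \<rho> V r \<in> carrier (R V)"
begin

lemma sec_module: "openin T U \<Longrightarrow> left_module (R U) (sec F U)"
  using sheaf[unfolded sheaf_of_modules_def, THEN conjunct1] by blast

lemma sec_group: "openin T U \<Longrightarrow> abelian_group (sec F U)"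
  using sec_module unfolding left_module_def by blast

lemma
  assumes "openin T U" "m \<in> carrier (sec F U)"
  shows one_smult: "\<one>\<^bsub>R U\<^esub> \<odot>\<^bsub>sec F U\<^esub> m = m"
    and smult_closed: "r \<in> carrier (R U) \<Longrightarrow> r \<odot>\<^bsub>sec F U\<^esub> m \<in> carrier (sec F U)"
    and smult_add: "r \<in> carrier (R U) \<Longrightarrow> n \<in> carrier (sec F U) \<Longrightarrow>
      r \<odot>\<^bsub>sec F U\<^esub> (m \<oplus>\<^bsub>sec F U\<^esub> n) = r \<odot>\<^bsub>sec F U\<^esub> m \<oplus>\<^bsub>sec F U\<^esub> r \<odot>\<^bsub>sec F U\<^esub> n"
    and add_smult: "r \<in> carrier (R U) \<Longrightarrow> t \<in> carrier (R U) \<Longrightarrow>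
      (r \<oplus>\<^bsub>R U\<^esub> t) \<odot>\<^bsub>sec F U\<^esub> m = r \<odot>\<^bsub>sec F U\<^esub> m \<oplus>\<^bsub>sec F U\<^esub> t \<odot>\<^bsub>sec F U\<^esub> m"
    and mult_smult: "r \<in> carrier (R U) \<Longrightarrow> t \<in> carrier (R U) \<Longrightarrow>
      (r \<otimes>\<^bsub>R U\<^esub> t) \<odot>\<^bsub>sec F U\<^esub> m = r \<odot>\<^bsub>sec F U\<^esub> (t \<odot>\<^bsub>sec F U\<^esub> m)"
  using sec_module[OF assms(1)] assms(2) unfolding left_module_def by simp_all

lemma smult_zero:
  assumes U: "openin T U" and r: "r \<in> carrier (R U)"
  shows "r \<odot>\<^bsub>sec F U\<^esub> \<zero>\<^bsub>sec F U\<^esub> = \<zero>\<^bsub>sec F U\<^esub>"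
proof -
  interpret abelian_group "sec F U" by (rule sec_group[OF U])
  have "r \<odot>\<^bsub>sec F U\<^esub> \<zero>\<^bsub>sec F U\<^esub> \<oplus>\<^bsub>sec F U\<^esub> r \<odot>\<^bsub>sec F U\<^esub> \<zero>\<^bsub>sec F U\<^esub> = r \<odot>\<^bsub>sec F U\<^esub> \<zero>\<^bsub>sec F U\<^esub>"
    using smult_add[OF U zero_closed r zero_closed] by simp
  then show ?thesis using smult_closed[OF U zero_closed r] by (simp add: add.l_cancel_one)
qed

lemma zero_smult:
  assumes U: "openin T U" and m: "m \<in> carrier (sec F U)"
  shows "\<zero>\<^bsub>R U\<^esub> \<odot>\<^bsub>sec F U\<^esub> m = \<zero>\<^bsub>sec F U\<^esub>"
proof -
  interpret abelian_group "sec F U" by (rule sec_group[OF U])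
  interpret R: ring "R U" by (rule ring_R[OF U])
  have "\<zero>\<^bsub>R U\<^esub> \<odot>\<^bsub>sec F U\<^esub> m \<oplus>\<^bsub>sec F U\<^esub> \<zero>\<^bsub>R U\<^esub> \<odot>\<^bsub>sec F U\<^esub> m = \<zero>\<^bsub>R U\<^esub> \<odot>\<^bsub>sec F U\<^esub> m"
    using add_smult[OF U m R.zero_closed R.zero_closed] by simp
  then show ?thesis using smult_closed[OF U m R.zero_closed] by (simp add: add.l_cancel_one)
qed

lemma
  assumes "openin T U" "openin T V" "V \<subseteq> U" "m \<in> carrier (sec F U)"
  shows res_closed: "res F U V m \<in> carrier (sec F V)"
    and res_add: "n \<in> carrier (sec F U) \<Longrightarrow>
      res F U V (m \<oplus>\<^bsub>sec F U\<^esub> n) = res F U V m \<oplus>\<^bsub>sec F V\<^esub> res F U V n"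
    and res_smult: "r \<in> carrier (R U) \<Longrightarrow> res F U V (r \<odot>\<^bsub>sec F U\<^esub> m) = \<rho> V r \<odot>\<^bsub>sec F V\<^esub> res F U V m"
  using sheaf[unfolded sheaf_of_modules_def, THEN conjunct2, THEN conjunct1, rule_format, OF conjI, OF assms(1) conjI, OF assms(2,3)]
    assms(4) by simp_all

lemma res_self: "openin T U \<Longrightarrow> m \<in> carrier (sec F U) \<Longrightarrow> res F U U m = m"
  using sheaf[unfolded sheaf_of_modules_def, THEN conjunct2, THEN conjunct2, THEN conjunct1] by blast

lemma res_res:
  assumes "openin T U" "openin T V" "openin T W" "W \<subseteq> V" "V \<subseteq> U" "m \<in> carrier (sec F U)"
  shows "res F V W (res F U V m) = res F U W m"
  using sheaf[unfolded sheaf_of_modules_def, THEN conjunct2, THEN conjunct2, THEN conjunct2, THEN conjunct1] assms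
  by blast

lemma res_zero:
  assumes "openin T U" "openin T V" "V \<subseteq> U"
  shows "res F U V \<zero>\<^bsub>sec F U\<^esub> = \<zero>\<^bsub>sec F V\<^esub>"
proof -
  interpret U: abelian_group "sec F U" by (rule sec_group[OF assms(1)])
  interpret V: abelian_group "sec F V" by (rule sec_group[OF assms(2)])
  show ?thesis
    using res_add[OF assms U.zero_closed U.zero_closed] res_closed[OF assms U.zero_closed]
    by (simp add: V.add.l_cancel_one)
qed

text \<open>
  The separation axiom in pointwise form: the good neighbourhoods of the points form a cover.
\<close>

lemma local_eqI:
  assumes U: "openin T U" and m: "m \<in> carrier (sec F U)" and n: "n \<in> carrier (sec F U)"
    and local: "\<And>x. x \<in> U \<Longrightarrow> \<exists>V. openin T V \<and> x \<in> V \<and> V \<subseteq> U \<and> res F U V m = res F U V n"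
  shows "m = n"
proof -
  define \<U> where "\<U> = {V. openin T V \<and> V \<subseteq> U \<and> res F U V m = res F U V n}"
  have "\<Union>\<U> = U" using local unfolding \<U>_def by blast
  moreover have "\<forall>V\<in>\<U>. openin T V" by (simp add: \<U>_def)
  ultimately have "(\<forall>V\<in>\<U>. res F U V m = res F U V n) \<longrightarrow> m = n"
    using sheaf[unfolded sheaf_of_modules_def, THEN conjunct2, THEN conjunct2, THEN conjunct2,
        THEN conjunct2, rule_format, THEN conjunct1, of \<U>] m n by simp
  then show ?thesis by (simp add: \<U>_def)
qed

end


section \<open>Subsheaves of finite type of coherent sheaves\<close>

lemma sub_msheaf_simps:
  "carrier (sec (sub_msheaf F N) U) = N U"
  "add (sec (sub_msheaf F N) U) = add (sec F U)"
  "zero (sec (sub_msheaf F N) U) = zero (sec F U)"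
  "smult (sec (sub_msheaf F N) U) = smult (sec F U)"
  "res (sub_msheaf F N) = res F"
  by (simp_all add: sub_msheaf_def)

text \<open>
  The value of a finite sum depends on the carrier recorded in the structure, so sums in a
  submodule have to be compared with sums in the ambient module.
\<close>

lemma finsum_submonoid:
  assumes M: "abelian_monoid M" and H: "H \<subseteq> carrier M" "\<zero>\<^bsub>M\<^esub> \<in> H"
    "\<And>x y. x \<in> H \<Longrightarrow> y \<in> H \<Longrightarrow> x \<oplus>\<^bsub>M\<^esub> y \<in> H"
    and "finite A" "f \<in> A \<rightarrow> H"
  shows "finsum (M\<lparr>carrier := H\<rparr>) f A = finsum M f A"
proof -
  interpret M: abelian_monoid M by (rule M)
  interpret H: abelian_monoid "M\<lparr>carrier := H\<rparr>"
    using H by (intro abelian_monoidI) (auto simp: M.a_ac subset_iff)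
  show ?thesis
    using assms(5,6)
  proof (induction A rule: finite_induct)
    case empty
    then show ?case by simp
  next
    case (insert a A)
    then have "f a \<in> H" "f \<in> A \<rightarrow> H" by auto
    moreover from this have "f a \<in> carrier M" "f \<in> A \<rightarrow> carrier M" using H(1) by auto
    ultimately show ?case using insert by (simp add: M.finsum_insert H.finsum_insert)
  qed
qed

context module_sheaf
begin

lemma
  assumes "submodule_sheaf T R F N" "openin T U"
  shows submodule_subset: "N U \<subseteq> carrier (sec F U)"
    and submodule_zero: "\<zero>\<^bsub>sec F U\<^esub> \<in> N U"
    and submodule_add: "m \<in> N U \<Longrightarrow> n \<in> N U \<Longrightarrow> m \<oplus>\<^bsub>sec F U\<^esub> n \<in> N U"
    and submodule_smult: "r \<in> carrier (R U) \<Longrightarrow> m \<in> N U \<Longrightarrow> r \<odot>\<^bsub>sec F U\<^esub> m \<in> N U"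
    and submodule_res: "openin T V \<Longrightarrow> V \<subseteq> U \<Longrightarrow> m \<in> N U \<Longrightarrow> res F U V m \<in> N V"
    and submodule_local: "m \<in> carrier (sec F U) \<Longrightarrow>
      (\<And>x. x \<in> U \<Longrightarrow> \<exists>V. openin T V \<and> x \<in> V \<and> V \<subseteq> U \<and> res F U V m \<in> N V) \<Longrightarrow> m \<in> N U"
  using assms(1)[unfolded submodule_sheaf_def, rule_format, OF assms(2)] by (auto simp: image_subset_iff)

lemma lincomb_sub:
  assumes N: "submodule_sheaf T R F N" and V: "openin T V"
    and "\<And>i. i < r \<Longrightarrow> c i \<in> carrier (R V)" "\<And>i. i < r \<Longrightarrow> ms i \<in> N V"
  shows "lincomb (sec (sub_msheaf F N) V) r c ms = lincomb (sec F V) r c ms"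
proof -
  have "sec (sub_msheaf F N) V = (sec F V)\<lparr>carrier := N V\<rparr>" by (simp add: sub_msheaf_def)
  moreover have "finsum ((sec F V)\<lparr>carrier := N V\<rparr>) (\<lambda>i. c i \<odot>\<^bsub>sec F V\<^esub> ms i) {..<r}
      = finsum (sec F V) (\<lambda>i. c i \<odot>\<^bsub>sec F V\<^esub> ms i) {..<r}"
    using submodule_subset[OF N V] submodule_zero[OF N V] submodule_add[OF N V] submodule_smult[OF N V]
      assms(3,4) sec_group[OF V]
    by (intro finsum_submonoid) (auto simp: abelian_group_def)
  ultimately show ?thesis by (simp add: lincomb_def)
qed

lemma is_relation_sub:
  assumes N: "submodule_sheaf T R F N" and "openin T U" "openin T V" "V \<subseteq> U"
    and "\<And>i. i < r \<Longrightarrow> ms i \<in> N U"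
  shows "is_relation R (sub_msheaf F N) U r ms V c \<longleftrightarrow> is_relation R F U r ms V c"
proof -
  have "lincomb (sec (sub_msheaf F N) V) r c (\<lambda>i. res F U V (ms i)) = lincomb (sec F V) r c (\<lambda>i. res F U V (ms i))"
    if "\<forall>i<r. c i \<in> carrier (R V)"
    using that assms submodule_res[OF N] by (intro lincomb_sub) auto
  then show ?thesis by (auto simp: is_relation_def sub_msheaf_simps)
qed

text \<open>The relations between sections of a subsheaf are the same in the subsheaf and in the ambient
  sheaf, so the finiteness of relations is inherited and only generators have to be supplied.\<close>

lemma coherent_sub:
  assumes coh: "coherent T R \<rho> F" and N: "submodule_sheaf T R F N"
    and gen: "generated_on T R (sub_msheaf F N) (topspace T) r ms"
  shows "coherent T R \<rho> (sub_msheaf F N)"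
  unfolding coherent_def
proof (intro conjI allI impI ballI)
  show "\<exists>U r ms. openin T U \<and> x \<in> U \<and> generated_on T R (sub_msheaf F N) U r ms" if "x \<in> topspace T" for x
    using gen that by blast
next
  fix U and r :: nat and ms x
  assume U: "openin T U \<and> (\<forall>i<r. ms i \<in> carrier (sec (sub_msheaf F N) U))" and x: "x \<in> U"
  then have ms: "\<And>i. i < r \<Longrightarrow> ms i \<in> N U" and oU: "openin T U" by (simp_all add: sub_msheaf_simps)
  have "openin T U \<and> (\<forall>i<r. ms i \<in> carrier (sec F U))"
    using ms submodule_subset[OF N oU] oU by blast
  from coh[unfolded coherent_def, THEN conjunct2, THEN spec, THEN spec, THEN spec, THEN mp, OF this, THEN bspec, OF x]
  obtain V and q :: nat and c where V: "openin T V" "x \<in> V" "V \<subseteq> U"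
    and c: "\<forall>j<q. is_relation R F U r ms V (c j)"
    and all: "\<forall>W b y. openin T W \<and> W \<subseteq> V \<and> y \<in> W \<and> is_relation R F U r ms W b \<longrightarrow>
              (\<exists>W' a. openin T W' \<and> y \<in> W' \<and> W' \<subseteq> W \<and> (\<forall>j<q. a j \<in> carrier (R W')) \<and>
                 (\<forall>i<r. \<rho> W' (b i) = (\<Oplus>\<^bsub>R W'\<^esub>j\<in>{..<q}. a j \<otimes>\<^bsub>R W'\<^esub> \<rho> W' (c j i))))"
    by (elim exE conjE) (rule that, assumption+)
  have eq: "is_relation R (sub_msheaf F N) U r ms W b \<longleftrightarrow> is_relation R F U r ms W b"
    if "openin T W" "W \<subseteq> V" for W b
    by (rule is_relation_sub[OF N oU that(1) subset_trans[OF that(2) V(3)]]) (rule ms)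
  show "\<exists>V (q::nat) c. openin T V \<and> x \<in> V \<and> V \<subseteq> U \<and>
           (\<forall>j<q. is_relation R (sub_msheaf F N) U r ms V (c j)) \<and>
           (\<forall>W b y. openin T W \<and> W \<subseteq> V \<and> y \<in> W \<and> is_relation R (sub_msheaf F N) U r ms W b \<longrightarrow>
              (\<exists>W' a. openin T W' \<and> y \<in> W' \<and> W' \<subseteq> W \<and> (\<forall>j<q. a j \<in> carrier (R W')) \<and>
                 (\<forall>i<r. \<rho> W' (b i) = (\<Oplus>\<^bsub>R W'\<^esub>j\<in>{..<q}. a j \<otimes>\<^bsub>R W'\<^esub> \<rho> W' (c j i)))))"
  proof (rule exI[of _ V], rule exI[of _ q], rule exI[of _ c], intro conjI allI impI; (elim conjE)?)
    show "is_relation R (sub_msheaf F N) U r ms V (c j)" if "j < q" for j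
      using c that eq[OF V(1) order_refl] by blast
    show "\<exists>W' a. openin T W' \<and> y \<in> W' \<and> W' \<subseteq> W \<and> (\<forall>j<q. a j \<in> carrier (R W')) \<and>
        (\<forall>i<r. \<rho> W' (b i) = (\<Oplus>\<^bsub>R W'\<^esub>j\<in>{..<q}. a j \<otimes>\<^bsub>R W'\<^esub> \<rho> W' (c j i)))"
      if "openin T W" "W \<subseteq> V" "y \<in> W" "is_relation R (sub_msheaf F N) U r ms W b" for W b y
      by (rule all[THEN spec, THEN spec, THEN spec, THEN mp]) (use that eq in simp)
  qed (fact V)+
qed

text \<open>
  The subsheaf generated by the global section \<open>m\<close>: its sections are multiples of \<open>m\<close> only
  locally, as the gluing of multiples need not be a multiple.
\<close>

definition cyclic_sub :: "'b \<Rightarrow> 'x set \<Rightarrow> 'b set" where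
  "cyclic_sub m U = {n \<in> carrier (sec F U). \<forall>x\<in>U. \<exists>V r. openin T V \<and> x \<in> V \<and> V \<subseteq> U \<and>
     r \<in> carrier (R V) \<and> res F U V n = r \<odot>\<^bsub>sec F V\<^esub> res F (topspace T) V m}"

lemma cyclic_sub_res:
  assumes m: "m \<in> carrier (sec F (topspace T))"
    and V: "openin T U" "openin T V" "openin T W" "W \<subseteq> V" "V \<subseteq> U"
    and n: "n \<in> carrier (sec F U)" and r: "r \<in> carrier (R V)"
    and eq: "res F U V n = r \<odot>\<^bsub>sec F V\<^esub> res F (topspace T) V m"
  shows "res F U W n = \<rho> W r \<odot>\<^bsub>sec F W\<^esub> res F (topspace T) W m"
proof -
  have top: "V \<subseteq> topspace T" using V(2) by (rule openin_subset)
  have "res F U W n = res F V W (r \<odot>\<^bsub>sec F V\<^esub> res F (topspace T) V m)"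
    using res_res[OF V n] eq by simp
  also have "\<dots> = \<rho> W r \<odot>\<^bsub>sec F W\<^esub> res F V W (res F (topspace T) V m)"
    using res_smult[OF V(2,3,4) res_closed[OF openin_topspace V(2) top m] r] .
  finally show ?thesis using res_res[OF openin_topspace V(2,3,4) top m] by simp
qed

lemma cyclic_submodule:
  assumes m: "m \<in> carrier (sec F (topspace T))"
  shows "submodule_sheaf T R F (cyclic_sub m)"
  unfolding submodule_sheaf_def
proof (intro allI impI conjI ballI subsetI)
  fix U assume U: "openin T U"
  interpret U: abelian_group "sec F U" by (rule sec_group[OF U])
  have m_res: "res F (topspace T) V m \<in> carrier (sec F V)" if "openin T V" for V
    using res_closed[OF openin_topspace that openin_subset[OF that] m] .
  show "n \<in> carrier (sec F U)" if "n \<in> cyclic_sub m U" for n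
    using that by (simp add: cyclic_sub_def)
  have "res F U U \<zero>\<^bsub>sec F U\<^esub> = \<zero>\<^bsub>R U\<^esub> \<odot>\<^bsub>sec F U\<^esub> res F (topspace T) U m"
    using res_zero[OF U U] zero_smult[OF U m_res[OF U]] by simp
  then show "\<zero>\<^bsub>sec F U\<^esub> \<in> cyclic_sub m U"
    using U ring.ring_simprules(2)[OF ring_R[OF U]] unfolding cyclic_sub_def by blast
  show "n \<oplus>\<^bsub>sec F U\<^esub> n' \<in> cyclic_sub m U" if n: "n \<in> cyclic_sub m U" "n' \<in> cyclic_sub m U" for n n'
    unfolding cyclic_sub_def
  proof (intro CollectI conjI ballI)
    fix x assume x: "x \<in> U"
    obtain V r where V: "openin T V" "x \<in> V" "V \<subseteq> U" "r \<in> carrier (R V)"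
      "res F U V n = r \<odot>\<^bsub>sec F V\<^esub> res F (topspace T) V m"
      using n(1) x unfolding cyclic_sub_def by blast
    obtain V' r' where V': "openin T V'" "x \<in> V'" "V' \<subseteq> U" "r' \<in> carrier (R V')"
      "res F U V' n' = r' \<odot>\<^bsub>sec F V'\<^esub> res F (topspace T) V' m"
      using n(2) x unfolding cyclic_sub_def by blast
    define W where "W = V \<inter> V'"
    have W: "openin T W" "x \<in> W" "W \<subseteq> U" "W \<subseteq> V" "W \<subseteq> V'" using V V' by (auto simp: W_def)
    have nc: "n \<in> carrier (sec F U)" "n' \<in> carrier (sec F U)" using n by (simp_all add: cyclic_sub_def)
    have r: "\<rho> W r \<in> carrier (R W)" "\<rho> W r' \<in> carrier (R W)"
      using scalar_res V V' W by blast+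
    have "res F U W (n \<oplus>\<^bsub>sec F U\<^esub> n') = (\<rho> W r \<oplus>\<^bsub>R W\<^esub> \<rho> W r') \<odot>\<^bsub>sec F W\<^esub> res F (topspace T) W m"
      using cyclic_sub_res[OF m U V(1) W(1,4) V(3) nc(1) V(4,5)]
        cyclic_sub_res[OF m U V'(1) W(1,5) V'(3) nc(2) V'(4,5)]
        res_add[OF U W(1,3) nc] add_smult[OF W(1) m_res[OF W(1)] r] by simp
    then show "\<exists>V r. openin T V \<and> x \<in> V \<and> V \<subseteq> U \<and> r \<in> carrier (R V) \<and>
        res F U V (n \<oplus>\<^bsub>sec F U\<^esub> n') = r \<odot>\<^bsub>sec F V\<^esub> res F (topspace T) V m"
      using W ring.ring_simprules(1)[OF ring_R[OF W(1)] r] by blast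
  qed (use n in \<open>simp add: cyclic_sub_def\<close>)
  show "t \<odot>\<^bsub>sec F U\<^esub> n \<in> cyclic_sub m U" if t: "t \<in> carrier (R U)" and n: "n \<in> cyclic_sub m U" for t n
    unfolding cyclic_sub_def
  proof (intro CollectI conjI ballI)
    have nc: "n \<in> carrier (sec F U)" using n by (simp add: cyclic_sub_def)
    then show "t \<odot>\<^bsub>sec F U\<^esub> n \<in> carrier (sec F U)" using smult_closed[OF U] t by blast
    fix x assume x: "x \<in> U"
    obtain V r where V: "openin T V" "x \<in> V" "V \<subseteq> U" "r \<in> carrier (R V)"
      "res F U V n = r \<odot>\<^bsub>sec F V\<^esub> res F (topspace T) V m"
      using n x unfolding cyclic_sub_def by blast
    have t': "\<rho> V t \<in> carrier (R V)" using scalar_res[OF U V(1,3) t] .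
    have "res F U V (t \<odot>\<^bsub>sec F U\<^esub> n) = (\<rho> V t \<otimes>\<^bsub>R V\<^esub> r) \<odot>\<^bsub>sec F V\<^esub> res F (topspace T) V m"
      using res_smult[OF U V(1,3) nc t] mult_smult[OF V(1) m_res[OF V(1)] t' V(4)] V(5) by simp
    then show "\<exists>V r. openin T V \<and> x \<in> V \<and> V \<subseteq> U \<and> r \<in> carrier (R V) \<and>
        res F U V (t \<odot>\<^bsub>sec F U\<^esub> n) = r \<odot>\<^bsub>sec F V\<^esub> res F (topspace T) V m"
      using V ring.ring_simprules(5)[OF ring_R[OF V(1)] t' V(4)] by blast
  qed
  show "n' \<in> cyclic_sub m V" if V: "openin T V \<and> V \<subseteq> U" and im: "n' \<in> res F U V ` cyclic_sub m U" for V n'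
  proof -
    obtain n where n: "n \<in> cyclic_sub m U" and n': "n' = res F U V n" using im by blast
    have nc: "n \<in> carrier (sec F U)" using n by (simp add: cyclic_sub_def)
    have oV: "openin T V" "V \<subseteq> U" using V by auto
    show ?thesis
      unfolding cyclic_sub_def
    proof (intro CollectI conjI ballI)
      show "n' \<in> carrier (sec F V)" using n' res_closed[OF U oV nc] by simp
      fix x assume x: "x \<in> V"
      then obtain V' r where V': "openin T V'" "x \<in> V'" "V' \<subseteq> U" "r \<in> carrier (R V')"
        "res F U V' n = r \<odot>\<^bsub>sec F V'\<^esub> res F (topspace T) V' m"
        using n oV unfolding cyclic_sub_def by blast
      define W where "W = V \<inter> V'"
      have W: "openin T W" "x \<in> W" "W \<subseteq> V" "W \<subseteq> V'" using oV V' x by (auto simp: W_def)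
      have "res F V W n' = \<rho> W r \<odot>\<^bsub>sec F W\<^esub> res F (topspace T) W m"
        using cyclic_sub_res[OF m U V'(1) W(1,4) V'(3) nc V'(4,5)] n' res_res[OF U oV(1) W(1,3) oV(2) nc] by simp
      then show "\<exists>W r. openin T W \<and> x \<in> W \<and> W \<subseteq> V \<and> r \<in> carrier (R W) \<and>
          res F V W n' = r \<odot>\<^bsub>sec F W\<^esub> res F (topspace T) W m"
        using W scalar_res[OF V'(1) W(1,4) V'(4)] by blast
    qed
  qed
  show "n \<in> cyclic_sub m U"
    if n: "n \<in> carrier (sec F U)"
      and loc: "\<forall>x\<in>U. \<exists>V. openin T V \<and> x \<in> V \<and> V \<subseteq> U \<and> res F U V n \<in> cyclic_sub m V" for n
    unfolding cyclic_sub_def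
  proof (intro CollectI conjI ballI n)
    fix x assume "x \<in> U"
    then obtain V where V: "openin T V" "x \<in> V" "V \<subseteq> U" "res F U V n \<in> cyclic_sub m V"
      using loc by blast
    then obtain W r where W: "openin T W" "x \<in> W" "W \<subseteq> V" "r \<in> carrier (R W)"
      "res F V W (res F U V n) = r \<odot>\<^bsub>sec F W\<^esub> res F (topspace T) W m"
      unfolding cyclic_sub_def by blast
    then have "res F U W n = r \<odot>\<^bsub>sec F W\<^esub> res F (topspace T) W m"
      using res_res[OF U V(1) W(1,3) V(3) n] by simp
    then show "\<exists>V r. openin T V \<and> x \<in> V \<and> V \<subseteq> U \<and> r \<in> carrier (R V) \<and>
        res F U V n = r \<odot>\<^bsub>sec F V\<^esub> res F (topspace T) V m"
      using W V(3) by blast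
  qed
qed

lemma cyclic_sub_generator:
  assumes m: "m \<in> carrier (sec F (topspace T))"
  shows "m \<in> cyclic_sub m (topspace T)"
proof -
  have "res F (topspace T) (topspace T) m = \<one>\<^bsub>R (topspace T)\<^esub> \<odot>\<^bsub>sec F (topspace T)\<^esub> res F (topspace T) (topspace T) m"
    using res_self[OF openin_topspace m] one_smult[OF openin_topspace m] by simp
  then show ?thesis
    using m ring.ring_simprules(6)[OF ring_R[OF openin_topspace]] unfolding cyclic_sub_def by blast
qed

lemma cyclic_sub_generated:
  assumes m: "m \<in> carrier (sec F (topspace T))"
  shows "generated_on T R (sub_msheaf F (cyclic_sub m)) (topspace T) 1 (\<lambda>i. m)"
  unfolding generated_on_def
proof (intro conjI allI impI ballI)
  show "m \<in> carrier (sec (sub_msheaf F (cyclic_sub m)) (topspace T))"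
    using cyclic_sub_generator[OF m] by (simp add: sub_msheaf_simps)
  note N = cyclic_submodule[OF m]
  fix V y n
  assume V: "openin T V \<and> V \<subseteq> topspace T \<and> y \<in> V" and n: "n \<in> carrier (sec (sub_msheaf F (cyclic_sub m)) V)"
  then obtain W r where W: "openin T W" "y \<in> W" "W \<subseteq> V" "r \<in> carrier (R W)"
    and eq: "res F V W n = r \<odot>\<^bsub>sec F W\<^esub> res F (topspace T) W m"
    unfolding sub_msheaf_simps cyclic_sub_def by blast
  interpret W: abelian_group "sec F W" by (rule sec_group[OF W(1)])
  have mW: "res F (topspace T) W m \<in> cyclic_sub m W"
    using submodule_res[OF N openin_topspace W(1) openin_subset[OF W(1)] cyclic_sub_generator[OF m]] .
  have mc: "r \<odot>\<^bsub>sec F W\<^esub> res F (topspace T) W m \<in> carrier (sec F W)"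
    using smult_closed[OF W(1) _ W(4)] mW submodule_subset[OF N W(1)] by blast
  have "lincomb (sec (sub_msheaf F (cyclic_sub m)) W) 1 (\<lambda>i. r) (\<lambda>i. res F (topspace T) W m)
      = lincomb (sec F W) 1 (\<lambda>i. r) (\<lambda>i. res F (topspace T) W m)"
    using W mW by (intro lincomb_sub[OF N]) auto
  also have "\<dots> = r \<odot>\<^bsub>sec F W\<^esub> res F (topspace T) W m"
    using mc by (simp add: lincomb_def lessThan_Suc W.finsum_insert)
  finally show "\<exists>W c. openin T W \<and> y \<in> W \<and> W \<subseteq> V \<and> (\<forall>i<1. c i \<in> carrier (R W)) \<and>
      res (sub_msheaf F (cyclic_sub m)) V W n = lincomb (sec (sub_msheaf F (cyclic_sub m)) W) 1 c
        (\<lambda>i. res (sub_msheaf F (cyclic_sub m)) (topspace T) W m)"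
    using W eq by (intro exI[of _ W] exI[of _ "\<lambda>i. r"]) (simp add: sub_msheaf_simps)
qed

lemma coherent_cyclic_sub:
  "coherent T R \<rho> F \<Longrightarrow> m \<in> carrier (sec F (topspace T)) \<Longrightarrow> coherent T R \<rho> (sub_msheaf F (cyclic_sub m))"
  by (rule coherent_sub[OF _ cyclic_submodule cyclic_sub_generated])

end


section \<open>Polynomials as constant term plus a multiple of the variable\<close>

context UP_ring
begin

lemma coeff_X_mult:
  assumes p: "p \<in> carrier P"
  shows "coeff P (monom P \<one> 1 \<otimes>\<^bsub>P\<^esub> p) n = (case n of 0 \<Rightarrow> \<zero> | Suc k \<Rightarrow> coeff P p k)"
proof (cases n)
  case 0
  then show ?thesis using p by simp
next
  case (Suc k)
  have "coeff P (monom P \<one> 1 \<otimes>\<^bsub>P\<^esub> p) n = (\<Oplus>i\<in>{..n}. if 1 = i then coeff P p (n - i) else \<zero>)"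
    unfolding coeff_mult[OF monom_closed[OF R.one_closed] p]
    using p by (intro R.finsum_cong') auto
  also have "\<dots> = coeff P p (n - 1)"
    using p Suc R.finsum_singleton[of 1 "{..n}" "\<lambda>i. coeff P p (n - i)"] by auto
  finally show ?thesis using Suc by simp
qed

text \<open>
  This reduces the action of \<open>D[s]\<close> modulo \<open>s\<close> to that of the constant term. The factor \<open>s\<close> is put
  on the left, so that it is applied last.
\<close>

lemma const_plus_X_mult:
  assumes p: "p \<in> carrier P"
  obtains q where "q \<in> carrier P" "p = monom P (coeff P p 0) 0 \<oplus>\<^bsub>P\<^esub> monom P \<one> 1 \<otimes>\<^bsub>P\<^esub> q"
proof
  let ?q = "\<lambda>j. p (Suc j)"
  have "p \<in> up R" using p by (simp add: P_def UP_def)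
  then obtain n where "bound \<zero> n p" by auto
  then have "bound \<zero> n ?q" by (simp add: bound_def)
  with \<open>p \<in> up R\<close> have q_up: "?q \<in> up R" by auto
  then show q: "?q \<in> carrier P" by (simp add: P_def UP_def)
  have coeff: "coeff P r k = r k" if "r \<in> up R" for r k
    using that by (simp add: P_def UP_def)
  show "p = monom P (coeff P p 0) 0 \<oplus>\<^bsub>P\<^esub> monom P \<one> 1 \<otimes>\<^bsub>P\<^esub> ?q"
  proof (rule up_eqI)
    fix k
    have X: "monom P \<one> 1 \<otimes>\<^bsub>P\<^esub> ?q \<in> carrier P" using q by simp
    show "coeff P p k = coeff P (monom P (coeff P p 0) 0 \<oplus>\<^bsub>P\<^esub> monom P \<one> 1 \<otimes>\<^bsub>P\<^esub> ?q) k"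
      unfolding coeff_add[OF monom_closed[OF coeff_closed[OF p]] X] coeff_X_mult[OF q]
      using p coeff[OF q_up] coeff[OF \<open>p \<in> up R\<close>] mem_upD[OF \<open>p \<in> up R\<close>]
      by (cases k) simp_all
  qed (use p q in simp_all)
qed

lemma monom_X_comm:
  assumes a: "a \<in> carrier R"
  shows "monom P a 0 \<otimes>\<^bsub>P\<^esub> monom P \<one> 1 = monom P \<one> 1 \<otimes>\<^bsub>P\<^esub> monom P a 0"
  using monom_mult[OF a R.one_closed, of 0 1] monom_mult[OF R.one_closed a, of 1 0] a by simp

end

lemma coeff_UP: "p \<in> carrier (UP R) \<Longrightarrow> up_ring.coeff (UP R) p k = p k"
  by (simp add: UP_def)

lemma monom_UP: "a \<in> carrier R \<Longrightarrow> up_ring.monom (UP R) a n = (\<lambda>i. if i = n then a else \<zero>\<^bsub>R\<^esub>)"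
  by (simp add: UP_def)


section \<open>The action on \<open>M[s] f\<^sup>s\<close> modulo \<open>s\<close>\<close>

lemma DX_simps:
  "carrier (DX X U) = diff_ops X U" "mult (DX X U) = op_comp" "one (DX X U) = mul_op X U (\<lambda>x. 1)"
  "zero (DX X U) = op_zero" "add (DX X U) = op_add"
  by (simp_all add: DX_def)

lemma Ms_fs_simps:
  "add (sec (Ms_fs X M act) U) = (\<lambda>u v j. u j \<oplus>\<^bsub>sec M U\<^esub> v j)"
  "zero (sec (Ms_fs X M act) U) = (\<lambda>j. \<zero>\<^bsub>sec M U\<^esub>)"
  "smult (sec (Ms_fs X M act) U) = act U"
  "res (Ms_fs X M act) = (\<lambda>U V u j. res M U V (u j))"
  by (simp_all add: Ms_fs_def)

context projective_set
begin

lemma UP_ring_DXs: "openin (top_of X) U \<Longrightarrow> UP_ring (DX X U)"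
  by (intro UP_ring.intro ring_DX)

lemma DXs_res_monom:
  assumes "openin (top_of X) U" "openin (top_of X) V" "V \<subseteq> U" "P \<in> diff_ops X U"
  shows "DXs_res V (up_ring.monom (DXs X U) P n) = up_ring.monom (DXs X V) (op_res V P) n"
  using assms diff_ops_res[OF assms(4,2,3)]
  by (auto simp: monom_UP DX_simps DXs_res_def op_res_op_zero fun_eq_iff)

lemma DXs_res_closed:
  assumes "openin (top_of X) U" "openin (top_of X) V" "V \<subseteq> U" "P \<in> carrier (DXs X U)"
  shows "DXs_res V P \<in> carrier (DXs X V)"
proof -
  have P: "P \<in> up (DX X U)" using assms by (simp add: UP_def)
  then obtain n where "bound op_zero n P" by (auto simp: up_def DX_simps)
  then have "bound op_zero n (DXs_res V P)"
    by (auto simp: bound_def DXs_res_def op_res_op_zero)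
  moreover have "DXs_res V P j \<in> diff_ops X V" for j
    using mem_upD[OF P, of j] assms diff_ops_res by (simp add: DX_simps DXs_res_def)
  ultimately have "DXs_res V P \<in> up (DX X V)" by (intro mem_upI) (auto simp: DX_simps)
  then show ?thesis by (simp add: UP_def)
qed

lemma op_res_mul_op_same: "V \<subseteq> U \<Longrightarrow> op_res V (mul_op X U g) = mul_op X V g"
  by (simp add: op_res_mul_op mul_op_restr)

lemma module_sheaf_DX: "DX_module X F \<Longrightarrow> module_sheaf (top_of X) (DX X) op_res F"
  by (rule module_sheaf.intro) (simp_all add: DX_module_def ring_DX DX_simps diff_ops_res)

lemma power_diff_ops:
  "f \<in> Hol X X \<Longrightarrow> openin (top_of X) U \<Longrightarrow> mul_op X U (\<lambda>x. f x ^ k) \<in> diff_ops X U"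
  by (intro mul_op_diff_ops Hol_power)

end

locale fs_module = projective_set X
  for X :: "(complex^'N) set set" +
  fixes f :: "(complex^'N) set \<Rightarrow> complex"
    and M :: "((complex^'N) set, (complex^'N) set operator, 'b) msheaf"
    and act :: "(complex^'N) set set \<Rightarrow> (nat \<Rightarrow> (complex^'N) set operator) \<Rightarrow> (nat \<Rightarrow> 'b) \<Rightarrow> (nat \<Rightarrow> 'b)"
  assumes f: "f \<in> Hol X X"
    and DX_module_M: "DX_module X M"
    and fs_action: "is_fs_action X f M act"
begin

sublocale M: module_sheaf "top_of X" "DX X" op_res M
  by (rule module_sheaf_DX[OF DX_module_M])

sublocale E: module_sheaf "top_of X" "DXs X" DXs_res "Ms_fs X M act"
proof (rule module_sheaf.intro)
  show "sheaf_of_modules (top_of X) (DXs X) DXs_res (Ms_fs X M act)"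
    using fs_action unfolding is_fs_action_def by (rule conjunct1)
  show "ring (DXs X U)" if "openin (top_of X) U" for U
    using UP_ring.UP_ring[OF UP_ring_DXs[OF that]] .
qed (rule DXs_res_closed)

abbreviation E_carrier :: "(complex^'N) set set \<Rightarrow> (nat \<Rightarrow> 'b) set" where
  "E_carrier U \<equiv> carrier (sec (Ms_fs X M act) U)"

definition svar :: "(complex^'N) set set \<Rightarrow> nat \<Rightarrow> (complex^'N) set operator" where
  "svar U = up_ring.monom (DXs X U) \<one>\<^bsub>DX X U\<^esub> 1"

abbreviation const :: "(complex^'N) set set \<Rightarrow> (complex^'N) set operator \<Rightarrow> nat \<Rightarrow> (complex^'N) set operator" where
  "const U P \<equiv> up_ring.monom (DXs X U) P 0"

text \<open>
  Multiplication by \<open>s\<close> on coefficient sequences.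
\<close>

definition shift :: "(complex^'N) set set \<Rightarrow> (nat \<Rightarrow> 'b) \<Rightarrow> nat \<Rightarrow> 'b" where
  "shift U u j = (case j of 0 \<Rightarrow> \<zero>\<^bsub>sec M U\<^esub> | Suc i \<Rightarrow> u i)"

lemma one_diff_ops: "openin (top_of X) U \<Longrightarrow> mul_op X U (\<lambda>x. 1) \<in> diff_ops X U"
  using power_diff_ops[OF f, of U 0] by simp

lemma svar_closed: "openin (top_of X) U \<Longrightarrow> svar U \<in> carrier (DXs X U)"
  using UP_ring.monom_closed[OF UP_ring_DXs] one_diff_ops by (simp add: DX_simps svar_def)

lemma const_closed: "openin (top_of X) U \<Longrightarrow> P \<in> diff_ops X U \<Longrightarrow> const U P \<in> carrier (DXs X U)"
  using UP_ring.monom_closed[OF UP_ring_DXs] by (simp add: DX_simps)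

lemma DXs_res_svar:
  assumes "openin (top_of X) U" "openin (top_of X) V" "V \<subseteq> U"
  shows "DXs_res V (svar U) = svar V"
  using DXs_res_monom[OF assms one_diff_ops[OF assms(1)]] op_res_mul_op_same[OF assms(3)]
  by (simp add: DX_simps svar_def)

lemma zero_closed: "openin (top_of X) U \<Longrightarrow> \<zero>\<^bsub>sec M U\<^esub> \<in> carrier (sec M U)"
  using M.sec_group abelian_group.a_inv_closed abelian_groupE(2) by blast

lemma E_coeff_closed: "u \<in> E_carrier U \<Longrightarrow> u j \<in> carrier (sec M U)"
  by (simp add: Ms_fs_def)

lemma E_locally_finite:
  "u \<in> E_carrier U \<Longrightarrow> x \<in> U \<Longrightarrow> \<exists>V d. openin (top_of X) V \<and> x \<in> V \<and> V \<subseteq> U \<and>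
            (\<forall>j>d. res M U V (u j) = \<zero>\<^bsub>sec M V\<^esub>)"
  by (simp add: Ms_fs_def)

lemma finite_in_E_carrier:
  assumes U: "openin (top_of X) U" and "\<And>j. u j \<in> carrier (sec M U)" "\<And>j. j > d \<Longrightarrow> u j = \<zero>\<^bsub>sec M U\<^esub>"
  shows "u \<in> E_carrier U"
proof -
  have "\<exists>V d. openin (top_of X) V \<and> x \<in> V \<and> V \<subseteq> U \<and> (\<forall>j>d. res M U V (u j) = \<zero>\<^bsub>sec M V\<^esub>)"
    if "x \<in> U" for x
    using U that assms(3) M.res_zero[OF U U] by (intro exI[of _ U] exI[of _ d]) simp
  then show ?thesis using assms(2) by (simp add: Ms_fs_def)
qed

lemma ms_term_closed:
  assumes "openin (top_of X) U" "n \<in> carrier (sec M U)"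
  shows "ms_term M U n j \<in> E_carrier U"
  using assms zero_closed by (intro finite_in_E_carrier[of U _ j]) (auto simp: ms_term_def)

lemma E_tail_closed:
  assumes "u \<in> E_carrier U"
  shows "(\<lambda>j. u (Suc j)) \<in> E_carrier U"
proof -
  have "\<exists>V d. openin (top_of X) V \<and> x \<in> V \<and> V \<subseteq> U \<and> (\<forall>j>d. res M U V (u (Suc j)) = \<zero>\<^bsub>sec M V\<^esub>)"
    if "x \<in> U" for x
    using E_locally_finite[OF assms that] less_SucI by (metis (no_types, lifting))
  then show ?thesis using E_coeff_closed[OF assms] by (simp add: Ms_fs_def)
qed

lemma shift_closed:
  assumes U: "openin (top_of X) U" and u: "u \<in> E_carrier U"
  shows "shift U u \<in> E_carrier U"
proof -
  have "\<exists>V d. openin (top_of X) V \<and> x \<in> V \<and> V \<subseteq> U \<and> (\<forall>j>d. res M U V (shift U u j) = \<zero>\<^bsub>sec M V\<^esub>)"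
    if x: "x \<in> U" for x
  proof -
    obtain V d where V: "openin (top_of X) V" "x \<in> V" "V \<subseteq> U" "\<forall>j>d. res M U V (u j) = \<zero>\<^bsub>sec M V\<^esub>"
      using E_locally_finite[OF u x] by blast
    then show ?thesis
      by (intro exI[of _ V] exI[of _ "Suc d"]) (auto simp: shift_def split: nat.split)
  qed
  then show ?thesis using E_coeff_closed[OF u] zero_closed[OF U]
    by (auto simp: Ms_fs_def shift_def split: nat.split)
qed

lemma
  assumes "openin (top_of X) U" "n \<in> carrier (sec M U)"
  shows act_svar_term: "act U (svar U) (ms_term M U n j) = ms_term M U n (Suc j)"
    and act_fun_term: "g \<in> Hol X U \<Longrightarrow>
      act U (const U (mul_op X U g)) (ms_term M U n j) = ms_term M U (fun_act X M U g n) j"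
    and act_vf_term: "\<xi> \<in> vector_fields X U \<Longrightarrow>
      act U (const U \<xi>) (ms_term M U n j) = ms_term M U (\<xi> \<odot>\<^bsub>sec M U\<^esub> n) j
        \<oplus>\<^bsub>sec (Ms_fs X M act) U\<^esub> ms_term M U (div_f X f M U (fun_act X M U (\<xi> U (restr U f)) n)) (Suc j)"
  unfolding svar_def
  using fs_action[unfolded is_fs_action_def, THEN conjunct2, rule_format, OF assms(2,1)] by blast+

lemma act_closed: "openin (top_of X) U \<Longrightarrow> P \<in> carrier (DXs X U) \<Longrightarrow> u \<in> E_carrier U \<Longrightarrow> act U P u \<in> E_carrier U"
  using E.smult_closed[of U u P] by (simp add: Ms_fs_simps)

text \<open>
  The action of \<open>s\<close> is prescribed on the terms \<open>n s\<^sup>j f\<^sup>s\<close>; a finite sum is treated by removing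
  its top term.
\<close>

lemma act_svar_finite:
  assumes U: "openin (top_of X) U"
  shows "(\<And>j. u j \<in> carrier (sec M U)) \<Longrightarrow> (\<And>j. j \<ge> d \<Longrightarrow> u j = \<zero>\<^bsub>sec M U\<^esub>) \<Longrightarrow>
    act U (svar U) u = shift U u"
proof (induction d arbitrary: u)
  case 0
  then have "u = (\<lambda>j. \<zero>\<^bsub>sec M U\<^esub>)" by auto
  then have "act U (svar U) u = (\<lambda>j. \<zero>\<^bsub>sec M U\<^esub>)"
    using E.smult_zero[OF U svar_closed[OF U]] by (simp add: Ms_fs_simps)
  moreover have "shift U u = (\<lambda>j. \<zero>\<^bsub>sec M U\<^esub>)"
    using 0 by (auto simp: shift_def fun_eq_iff split: nat.split)
  ultimately show ?case by simp
next
  case (Suc d)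
  interpret U: abelian_group "sec M U" by (rule M.sec_group[OF U])
  define w where "w = u(d := \<zero>\<^bsub>sec M U\<^esub>)"
  have w: "\<And>j. w j \<in> carrier (sec M U)" "\<And>j. j \<ge> d \<Longrightarrow> w j = \<zero>\<^bsub>sec M U\<^esub>"
    using Suc.prems by (auto simp: w_def)
  have IH: "act U (svar U) w = shift U w" by (rule Suc.IH) (use w in auto)
  have wE: "w \<in> E_carrier U" by (rule finite_in_E_carrier[of U _ d]) (use U w in auto)
  have "u = w \<oplus>\<^bsub>sec (Ms_fs X M act) U\<^esub> ms_term M U (u d) d"
    using Suc.prems(1) by (auto simp: Ms_fs_simps w_def ms_term_def)
  then have "act U (svar U) u = act U (svar U) w \<oplus>\<^bsub>sec (Ms_fs X M act) U\<^esub> ms_term M U (u d) (Suc d)"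
    using E.smult_add[OF U wE svar_closed[OF U] ms_term_closed[OF U Suc.prems(1)], of d d]
      act_svar_term[OF U Suc.prems(1)] by (simp add: Ms_fs_simps)
  also have "\<dots> = shift U u"
    unfolding IH
    using Suc.prems(1) by (auto simp: Ms_fs_simps shift_def w_def ms_term_def split: nat.split)
  finally show ?case .
qed

text \<open>
  Locally a section is a finite sum, and the two sides are compared on such neighbourhoods.
\<close>

lemma act_svar:
  assumes U: "openin (top_of X) U" and u: "u \<in> E_carrier U"
  shows "act U (svar U) u = shift U u"
proof (rule E.local_eqI[OF U act_closed[OF U svar_closed[OF U] u] shift_closed[OF U u]])
  fix x assume "x \<in> U"
  then obtain V d where V: "openin (top_of X) V" "x \<in> V" "V \<subseteq> U"
    and fin: "\<forall>j>d. res M U V (u j) = \<zero>\<^bsub>sec M V\<^esub>"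
    using E_locally_finite[OF u] by blast
  let ?v = "\<lambda>j. res M U V (u j)"
  have "res (Ms_fs X M act) U V (act U (svar U) u) = act V (svar V) ?v"
    using E.res_smult[OF U V(1,3) u svar_closed[OF U]] DXs_res_svar[OF U V(1,3)]
    by (simp add: Ms_fs_simps)
  also have "\<dots> = shift V ?v"
    by (rule act_svar_finite[OF V(1), of _ "Suc d"])
      (use fin M.res_closed[OF U V(1,3) E_coeff_closed[OF u]] in auto)
  also have "\<dots> = res (Ms_fs X M act) U V (shift U u)"
    using M.res_zero[OF U V(1,3)] by (auto simp: Ms_fs_simps shift_def split: nat.split)
  finally show "\<exists>V. openin (top_of X) V \<and> x \<in> V \<and> V \<subseteq> U \<and>
      res (Ms_fs X M act) U V (act U (svar U) u) = res (Ms_fs X M act) U V (shift U u)"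
    using V by blast
qed

lemma act_svar_0: "openin (top_of X) U \<Longrightarrow> u \<in> E_carrier U \<Longrightarrow> act U (svar U) u 0 = \<zero>\<^bsub>sec M U\<^esub>"
  by (simp add: act_svar shift_def)

text \<open>
  Hence \<open>s M[s] f\<^sup>s\<close> consists of the sections whose coefficient at \<open>s\<^sup>0\<close> vanishes.
\<close>

lemma split_off_const:
  assumes U: "openin (top_of X) U" and u: "u \<in> E_carrier U"
  shows "u = ms_term M U (u 0) 0 \<oplus>\<^bsub>sec (Ms_fs X M act) U\<^esub> act U (svar U) (\<lambda>j. u (Suc j))"
proof -
  interpret U: abelian_group "sec M U" by (rule M.sec_group[OF U])
  show ?thesis
    using E_coeff_closed[OF u]
    by (auto simp: act_svar[OF U E_tail_closed[OF u]] Ms_fs_simps shift_def ms_term_def split: nat.split)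
qed

text \<open>
  Operators commute with \<open>s\<close> and so preserve \<open>s M[s] f\<^sup>s\<close>; the coefficient of \<open>P u\<close> at \<open>s\<^sup>0\<close>
  depends only on that of \<open>u\<close>.
\<close>

lemma act_const_0_cong:
  assumes U: "openin (top_of X) U" and u: "u \<in> E_carrier U" and P: "P \<in> diff_ops X U"
  shows "act U (const U P) u 0 = act U (const U P) (ms_term M U (u 0) 0) 0"
proof -
  interpret U: abelian_group "sec M U" by (rule M.sec_group[OF U])
  interpret P: UP_ring "DX X U" "DXs X U" by (simp_all add: UP_ring_DXs[OF U])
  let ?v = "\<lambda>j. u (Suc j)"
  note c = const_closed[OF U P] and s = svar_closed[OF U] and v = E_tail_closed[OF u]
  note t = ms_term_closed[OF U E_coeff_closed[OF u, of 0], of 0]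
  have "act U (const U P) (act U (svar U) ?v) = act U (svar U) (act U (const U P) ?v)"
    using E.mult_smult[OF U v c s] E.mult_smult[OF U v s c] P.monom_X_comm[of P] P
    by (simp add: Ms_fs_simps DX_simps svar_def)
  then have "act U (const U P) (act U (svar U) ?v) 0 = \<zero>\<^bsub>sec M U\<^esub>"
    using act_svar_0[OF U act_closed[OF U c v]] by simp
  moreover have "act U (const U P) u = act U (const U P) (ms_term M U (u 0) 0)
      \<oplus>\<^bsub>sec (Ms_fs X M act) U\<^esub> act U (const U P) (act U (svar U) ?v)"
    using E.smult_add[OF U t c act_closed[OF U s v]] split_off_const[OF U u]
    by (simp add: Ms_fs_simps)
  ultimately show ?thesis
    using E_coeff_closed[OF act_closed[OF U c t], of 0] by (simp add: Ms_fs_simps)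
qed

text \<open>
  In the formula for a vector field \<open>\<xi>\<close> the term with \<open>\<xi>(f)/f\<close> carries an additional factor \<open>s\<close>
  and is invisible at \<open>s\<^sup>0\<close>, where \<open>\<xi>\<close> acts as it does on \<open>M\<close>. The module laws extend this to
  sums and composites.
\<close>

lemma act_diff_gen_0:
  assumes U: "openin (top_of X) U"
  shows "diff_gen X U p P \<Longrightarrow> u \<in> E_carrier U \<Longrightarrow> act U (const U P) u 0 = P \<odot>\<^bsub>sec M U\<^esub> u 0"
proof (induction arbitrary: u rule: diff_gen.induct)
  interpret U: abelian_group "sec M U" by (rule M.sec_group[OF U])
  interpret P: UP_ring "DX X U" "DXs X U" by (simp_all add: UP_ring_DXs[OF U])
  have mul: "act U (const U (mul_op X U g)) u 0 = mul_op X U g \<odot>\<^bsub>sec M U\<^esub> u 0"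
    if g: "g \<in> Hol X U" and u: "u \<in> E_carrier U" for g u
    using act_const_0_cong[OF U u diff_gen_diff_ops[OF U gen_fun[OF g]]]
      act_fun_term[OF U E_coeff_closed[OF u] g]
    by (simp add: ms_term_def)
  have vf: "act U (const U \<xi>) u 0 = \<xi> \<odot>\<^bsub>sec M U\<^esub> u 0"
    if \<xi>: "\<xi> \<in> vector_fields X U" and u: "u \<in> E_carrier U" for \<xi> u
  proof -
    note D = vector_fields_diff_ops[OF U \<xi>]
    have "\<xi> \<odot>\<^bsub>sec M U\<^esub> u 0 \<in> carrier (sec M U)"
      using M.smult_closed[OF U E_coeff_closed[OF u]] D by (simp add: DX_simps)
    then show ?thesis
      using act_const_0_cong[OF U u D] act_vf_term[OF U E_coeff_closed[OF u] \<xi>]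
      by (simp add: ms_term_def Ms_fs_simps)
  qed
  have comp: "act U (const U (op_comp P Q)) u 0 = op_comp P Q \<odot>\<^bsub>sec M U\<^esub> u 0"
    if P: "P \<in> diff_ops X U" and Q: "Q \<in> diff_ops X U" and u: "u \<in> E_carrier U"
      and 1: "\<And>v. v \<in> E_carrier U \<Longrightarrow> act U (const U P) v 0 = P \<odot>\<^bsub>sec M U\<^esub> v 0"
      and 2: "\<And>v. v \<in> E_carrier U \<Longrightarrow> act U (const U Q) v 0 = Q \<odot>\<^bsub>sec M U\<^esub> v 0" for P Q u
  proof -
    have "const U (op_comp P Q) = const U P \<otimes>\<^bsub>DXs X U\<^esub> const U Q"
      using P.monom_mult[of P Q 0 0] P Q by (simp add: DX_simps)
    then have "act U (const U (op_comp P Q)) u = act U (const U P) (act U (const U Q) u)"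
      using E.mult_smult[OF U u const_closed[OF U P] const_closed[OF U Q]] by (simp add: Ms_fs_simps)
    then show ?thesis
      using 1[OF act_closed[OF U const_closed[OF U Q] u]] 2[OF u]
        M.mult_smult[OF U E_coeff_closed[OF u], of P Q] P Q by (simp add: DX_simps)
  qed
  { case (gen_fun g)
    then show ?case by (simp add: mul)
  next
    case (gen_add p P Q)
    note D = gen_add.hyps[THEN diff_gen_diff_ops[OF U]]
    have "const U (op_add P Q) = const U P \<oplus>\<^bsub>DXs X U\<^esub> const U Q"
      using P.monom_add[of P Q 0] D by (simp add: DX_simps)
    then have "act U (const U (op_add P Q)) u = (\<lambda>j. act U (const U P) u j \<oplus>\<^bsub>sec M U\<^esub> act U (const U Q) u j)"
      using E.add_smult[OF U gen_add.prems const_closed[OF U D(1)] const_closed[OF U D(2)]]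
      by (simp add: Ms_fs_simps)
    then show ?case
      using gen_add.IH gen_add.prems M.add_smult[OF U E_coeff_closed[OF gen_add.prems], of P Q] D
      by (simp add: DX_simps)
  next
    case (gen_fun_mult g p P)
    then show ?case
      by (intro comp diff_gen_diff_ops[OF U gen_fun] diff_gen_diff_ops[OF U] mul)
  next
    case (gen_vf_mult \<xi> p P)
    show ?case
      by (rule comp[OF vector_fields_diff_ops[OF U gen_vf_mult.hyps(1)]
            diff_gen_diff_ops[OF U gen_vf_mult.hyps(2)] gen_vf_mult.prems
            vf[OF gen_vf_mult.hyps(1)] gen_vf_mult.IH])
  next
    case (gen_mono p P)
    then show ?case by simp }
qed

text \<open>
  Generation by functions and vector fields is a local property, hence the passage to
  neighbourhoods.
\<close>

lemma act_const_0:
  assumes U: "openin (top_of X) U" and u: "u \<in> E_carrier U" and P: "P \<in> diff_ops X U"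
  shows "act U (const U P) u 0 = P \<odot>\<^bsub>sec M U\<^esub> u 0"
proof (rule M.local_eqI[OF U])
  show "act U (const U P) u 0 \<in> carrier (sec M U)"
    by (rule E_coeff_closed[OF act_closed[OF U const_closed[OF U P] u]])
  show "P \<odot>\<^bsub>sec M U\<^esub> u 0 \<in> carrier (sec M U)"
    using M.smult_closed[OF U E_coeff_closed[OF u]] P by (simp add: DX_simps)
  fix x assume "x \<in> U"
  then obtain V p where V: "openin (top_of X) V" "x \<in> V" "V \<subseteq> U" and gen: "diff_gen X V p (op_res V P)"
    using P unfolding diff_ops_def by blast
  have uV: "(\<lambda>j. res M U V (u j)) \<in> E_carrier V"
    using E.res_closed[OF U V(1,3) u] by (simp add: Ms_fs_simps)
  have "(\<lambda>j. res M U V (act U (const U P) u j)) = act V (const V (op_res V P)) (\<lambda>j. res M U V (u j))"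
    using E.res_smult[OF U V(1,3) u const_closed[OF U P]] DXs_res_monom[OF U V(1,3) P]
    by (simp add: Ms_fs_simps)
  then have "res M U V (act U (const U P) u 0) = op_res V P \<odot>\<^bsub>sec M V\<^esub> res M U V (u 0)"
    using act_diff_gen_0[OF V(1) gen uV] by (metis (no_types, lifting))
  also have "\<dots> = res M U V (P \<odot>\<^bsub>sec M U\<^esub> u 0)"
    using M.res_smult[OF U V(1,3) E_coeff_closed[OF u]] P by (simp add: DX_simps)
  finally show "\<exists>V. openin (top_of X) V \<and> x \<in> V \<and> V \<subseteq> U \<and>
      res M U V (act U (const U P) u 0) = res M U V (P \<odot>\<^bsub>sec M U\<^esub> u 0)"
    using V by blast
qed

text \<open>
  The quotient of \<open>M[s] f\<^sup>s\<close> by \<open>s M[s] f\<^sup>s\<close> is \<open>M\<close>, with \<open>D[s]\<close> acting through \<open>s \<mapsto> 0\<close>.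
\<close>

lemma act_0:
  assumes U: "openin (top_of X) U" and u: "u \<in> E_carrier U" and P: "P \<in> carrier (DXs X U)"
  shows "act U P u 0 = P 0 \<odot>\<^bsub>sec M U\<^esub> u 0"
proof -
  interpret U: abelian_group "sec M U" by (rule M.sec_group[OF U])
  interpret P: UP_ring "DX X U" "DXs X U" by (simp_all add: UP_ring_DXs[OF U])
  have P0: "P 0 \<in> diff_ops X U"
    using P.coeff_closed[OF P, of 0] coeff_UP[OF P, of 0] by (simp add: DX_simps)
  obtain Q where Q: "Q \<in> carrier (DXs X U)"
    and eq: "P = const U (P 0) \<oplus>\<^bsub>DXs X U\<^esub> svar U \<otimes>\<^bsub>DXs X U\<^esub> Q"
    using P.const_plus_X_mult[OF P] coeff_UP[OF P, of 0] unfolding svar_def by metis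
  note s = svar_closed[OF U] and c = const_closed[OF U P0]
  have "act U P u = (\<lambda>j. act U (const U (P 0)) u j \<oplus>\<^bsub>sec M U\<^esub> act U (svar U) (act U Q u) j)"
    using E.add_smult[OF U u c P.UP_mult_closed[OF s Q]] E.mult_smult[OF U u s Q] eq
    by (simp add: Ms_fs_simps)
  moreover have "P 0 \<odot>\<^bsub>sec M U\<^esub> u 0 \<in> carrier (sec M U)"
    using M.smult_closed[OF U E_coeff_closed[OF u]] P0 by (simp add: DX_simps)
  ultimately show ?thesis
    using act_const_0[OF U u P0] act_svar_0[OF U act_closed[OF U Q u]] by simp
qed

end


section \<open>The invariant and the membership criterion\<close>

text \<open>
  The infimum of the empty set is \<open>\<infinity>\<close>, so a vanishing infimum is attained.
\<close>

lemma Inf_enat_eq_0_iff: "Inf {enat l | l. Q l} = 0 \<longleftrightarrow> Q 0"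
proof
  assume eq: "Inf {enat l | l. Q l} = 0"
  then have "{enat l | l. Q l} \<noteq> {}" by (auto simp: Inf_enat_def split: if_split_asm)
  then have "Inf {enat l | l. Q l} \<in> {enat l | l. Q l}"
    unfolding Inf_enat_def by (metis (no_types, lifting) LeastI ex_in_conv)
  then show "Q 0" unfolding eq by (auto simp: zero_enat_def)
next
  assume "Q 0"
  then have "0 \<in> {enat l | l. Q l}" by (auto simp: zero_enat_def)
  then have "Inf {enat l | l. Q l} \<le> 0" by (rule Inf_lower)
  then show "Inf {enat l | l. Q l} = 0" by simp
qed

lemma topspace_top_of: "X \<subseteq> proj_space \<Longrightarrow> topspace (top_of X) = X"
  using openin_proj_space openin_subset by fastforce

context projective_set
begin

lemma mul_op_comp:
  assumes h: "restr U h \<in> Hol X U"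
  shows "op_comp (mul_op X U g) (mul_op X U h) = mul_op X U (\<lambda>x. g x * h x)"
proof (intro ext)
  fix V k x
  show "op_comp (mul_op X U g) (mul_op X U h) V k x = mul_op X U (\<lambda>x. g x * h x) V k x"
  proof (cases "openin (top_of X) V \<and> V \<subseteq> U \<and> k \<in> Hol X V")
    case True
    then have "mul_op X U h V k \<in> Hol X V"
      using sheaf_end_apply(1)[OF mul_op_sheaf_end[OF h], of V k] by (simp add: mul_op_restr)
    then show ?thesis using True by (simp add: op_comp_def mul_op_def)
  next
    case False
    then have "mul_op X U h V k = (\<lambda>x. 0)" unfolding mul_op_def by (intro ext) (rule if_not_P)
    then show ?thesis using False by (auto simp: op_comp_def mul_op_def)
  qed
qed

text \<open>
  The subsheaf generated by a nonzero section \<open>u\<close> is coherent and nonzero, hence by simplicity all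
  of \<open>S\<close>; every other section is locally a multiple of \<open>u\<close>.
\<close>

lemma simple_generated:
  assumes simple: "simple_DX_module X S" and coh: "coherent (top_of X) (DX X) op_res S"
    and u: "u \<in> carrier (sec S X)" "u \<noteq> \<zero>\<^bsub>sec S X\<^esub>" and v: "v \<in> carrier (sec S X)" and x: "x \<in> X"
  obtains V r where "openin (top_of X) V" "x \<in> V" "r \<in> diff_ops X V"
    "res S X V v = r \<odot>\<^bsub>sec S V\<^esub> res S X V u"
proof -
  interpret S: module_sheaf "top_of X" "DX X" op_res S
    using simple by (intro module_sheaf_DX) (simp add: simple_DX_module_def)
  note top = topspace_top_of[OF in_proj_space]
  have uT: "u \<in> carrier (sec S (topspace (top_of X)))" using u top by simp
  have "zero_msheaf (top_of X) (sub_msheaf S (S.cyclic_sub u)) \<or>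
      (\<forall>U. openin (top_of X) U \<longrightarrow> S.cyclic_sub u U = carrier (sec S U))"
    using simple S.cyclic_submodule[OF uT] S.coherent_cyclic_sub[OF coh uT]
    unfolding simple_DX_module_def by blast
  moreover have "\<not> zero_msheaf (top_of X) (sub_msheaf S (S.cyclic_sub u))"
    using S.cyclic_sub_generator[OF uT] u(2) openin_self
    unfolding zero_msheaf_def sub_msheaf_simps top by blast
  ultimately have "v \<in> S.cyclic_sub u X" using openin_self v by blast
  then show ?thesis
    using x that unfolding S.cyclic_sub_def top DX_simps by blast
qed

end

context fs_module
begin

lemma power_Hol: "openin (top_of X) U \<Longrightarrow> restr U (\<lambda>x. f x ^ k) \<in> Hol X U"
  by (rule Hol_power[OF f])

lemma power_act_closed:
  "openin (top_of X) U \<Longrightarrow> n \<in> carrier (sec M U) \<Longrightarrow> fun_act X M U (\<lambda>x. f x ^ k) n \<in> carrier (sec M U)"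
  using M.smult_closed[of U n] power_diff_ops[OF f] by (simp add: DX_simps)

lemma power_0_act: "openin (top_of X) U \<Longrightarrow> n \<in> carrier (sec M U) \<Longrightarrow> fun_act X M U (\<lambda>x. f x ^ 0) n = n"
  using M.one_smult[of U n] by (simp add: DX_simps)

lemma power_Suc_act:
  assumes U: "openin (top_of X) U" and n: "n \<in> carrier (sec M U)"
  shows "fun_act X M U (\<lambda>x. f x ^ Suc k) n = fun_act X M U f (fun_act X M U (\<lambda>x. f x ^ k) n)"
  using M.mult_smult[OF U n] mul_op_comp[OF power_Hol[OF U], of f k, symmetric]
    power_diff_ops[OF f U, of 1] power_diff_ops[OF f U, of k]
  by (simp add: DX_simps)

lemma power_act_res:
  assumes "openin (top_of X) U" "openin (top_of X) V" "V \<subseteq> U" "n \<in> carrier (sec M U)"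
  shows "res M U V (fun_act X M U (\<lambda>x. f x ^ k) n) = fun_act X M V (\<lambda>x. f x ^ k) (res M U V n)"
  using M.res_smult[OF assms] power_diff_ops[OF f assms(1)] op_res_mul_op_same[OF assms(3)]
  by (simp add: DX_simps)

lemma
  assumes V: "openin (top_of X) V"
  shows s_plus_0: "s_plus X V 0 = svar V"
    and svar_pow_0: "svar V [^]\<^bsub>DXs X V\<^esub> (0::nat) = \<one>\<^bsub>DXs X V\<^esub>"
    and svar_pow_1: "svar V [^]\<^bsub>DXs X V\<^esub> (1::nat) = svar V"
proof -
  interpret P: UP_ring "DX X V" "DXs X V" by (simp_all add: UP_ring_DXs[OF V])
  have "const V op_zero = \<zero>\<^bsub>DXs X V\<^esub>"
    using P.monom_zero[of 0] by (simp add: DX_simps)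
  then show "s_plus X V 0 = svar V"
    using svar_closed[OF V] by (simp add: s_plus_def svar_def mul_op_zero)
  show "svar V [^]\<^bsub>DXs X V\<^esub> (0::nat) = \<one>\<^bsub>DXs X V\<^esub>" by simp
  show "svar V [^]\<^bsub>DXs X V\<^esub> (1::nat) = svar V"
    using svar_closed[OF V] by (rule P.P.nat_pow_eone)
qed

text \<open>
  The congruence that defines \<open>\<ell>\<^sub>k\<close>, for \<open>\<ell> = 0\<close> and \<open>\<alpha> = 0\<close>: comparing coefficients at \<open>s\<^sup>0\<close> gives
  \<open>P\<^sub>0 (f\<^sup>k n) = n\<close>, and conversely an operator with this property changes \<open>n f\<^bsup>s+k\<^esup>\<close> into \<open>n f\<^sup>s\<close> up to a
  multiple of \<open>s\<close>.
\<close>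

lemma congruence_mod_s_iff:
  assumes V: "openin (top_of X) V" and n: "n \<in> carrier (sec M V)"
  shows "(\<exists>P\<in>carrier (DXs X V). \<exists>q\<in>E_carrier V.
          act V P (m_fsk X f M V n k)
          = act V (s_plus X V 0 [^]\<^bsub>DXs X V\<^esub> (0::nat)) (m_fsk X f M V n 0)
            \<oplus>\<^bsub>sec (Ms_fs X M act) V\<^esub> act V (s_plus X V 0 [^]\<^bsub>DXs X V\<^esub> (0 + 1 :: nat)) q)
     \<longleftrightarrow> (\<exists>P\<in>diff_ops X V. P \<odot>\<^bsub>sec M V\<^esub> fun_act X M V (\<lambda>x. f x ^ k) n = n)"
    (is "?lhs \<longleftrightarrow> ?rhs")
proof -
  interpret V: abelian_group "sec M V" by (rule M.sec_group[OF V])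
  interpret P: UP_ring "DX X V" "DXs X V" by (simp_all add: UP_ring_DXs[OF V])
  let ?g = "fun_act X M V (\<lambda>x. f x ^ k) n"
  have g: "?g \<in> carrier (sec M V)" by (rule power_act_closed[OF V n])
  note gE = ms_term_closed[OF V g, of 0] and nE = ms_term_closed[OF V n, of 0]
  have rhs: "act V (s_plus X V 0 [^]\<^bsub>DXs X V\<^esub> (0::nat)) (m_fsk X f M V n 0)
            \<oplus>\<^bsub>sec (Ms_fs X M act) V\<^esub> act V (s_plus X V 0 [^]\<^bsub>DXs X V\<^esub> (0 + 1 :: nat)) q
          = ms_term M V n 0 \<oplus>\<^bsub>sec (Ms_fs X M act) V\<^esub> act V (svar V) q" for q
    using E.one_smult[OF V nE] svar_pow_0[OF V] svar_pow_1[OF V] power_0_act[OF V n]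
    by (simp add: s_plus_0[OF V] m_fsk_def Ms_fs_simps)
  show ?thesis
    unfolding rhs unfolding m_fsk_def
  proof
    assume "\<exists>P\<in>carrier (DXs X V). \<exists>q\<in>E_carrier V. act V P (ms_term M V ?g 0)
        = ms_term M V n 0 \<oplus>\<^bsub>sec (Ms_fs X M act) V\<^esub> act V (svar V) q"
    then obtain P q where P: "P \<in> carrier (DXs X V)" and q: "q \<in> E_carrier V"
      and eq: "act V P (ms_term M V ?g 0) = ms_term M V n 0 \<oplus>\<^bsub>sec (Ms_fs X M act) V\<^esub> act V (svar V) q"
      by blast
    have "P 0 \<odot>\<^bsub>sec M V\<^esub> ?g = n"
      using act_0[OF V gE P] act_svar_0[OF V q] n unfolding eq by (simp add: Ms_fs_simps ms_term_def)
    moreover have "P 0 \<in> diff_ops X V"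
      using P.coeff_closed[OF P, of 0] coeff_UP[OF P, of 0] by (simp add: DX_simps)
    ultimately show ?rhs by blast
  next
    assume ?rhs
    then obtain P where P: "P \<in> diff_ops X V" and eq: "P \<odot>\<^bsub>sec M V\<^esub> ?g = n" by blast
    let ?u = "act V (const V P) (ms_term M V ?g 0)"
    have u: "?u \<in> E_carrier V" by (rule act_closed[OF V const_closed[OF V P] gE])
    have "?u 0 = n" using act_const_0[OF V gE P] eq by (simp add: ms_term_def)
    then have "?u = ms_term M V n 0 \<oplus>\<^bsub>sec (Ms_fs X M act) V\<^esub> act V (svar V) (\<lambda>j. ?u (Suc j))"
      using split_off_const[OF V u] by simp
    then show "\<exists>P\<in>carrier (DXs X V). \<exists>q\<in>E_carrier V. act V P (ms_term M V ?g 0)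
        = ms_term M V n 0 \<oplus>\<^bsub>sec (Ms_fs X M act) V\<^esub> act V (svar V) q"
      using const_closed[OF V P] E_tail_closed[OF u] by blast
  qed
qed

lemma ell_eq_0_iff:
  assumes m: "m \<in> carrier (sec M X)"
  shows "ell X f M act m 0 k = 0 \<longleftrightarrow> (\<forall>x\<in>X. \<exists>V. openin (top_of X) V \<and> x \<in> V \<and>
    (\<exists>P\<in>diff_ops X V. P \<odot>\<^bsub>sec M V\<^esub> fun_act X M V (\<lambda>x. f x ^ k) (res M X V m) = res M X V m))"
  unfolding ell_def Inf_enat_eq_0_iff
  using congruence_mod_s_iff[OF _ M.res_closed[OF openin_self _ _ m], OF _ _ openin_sub]
  by (intro ball_cong ex_cong1 conj_cong refl)

text \<open>
  As \<open>n f\<^bsup>s+k+1\<^esup> = f \<cdot> n f\<^bsup>s+k\<^esup>\<close>, an operator \<open>P\<close> that is admissible for \<open>k + 1\<close> gives the operator \<open>P f\<close>, which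
  is admissible for \<open>k\<close> with the same \<open>\<ell>\<close>. Monotonicity makes the limit that defines \<open>\<omega>\<close> a supremum.
\<close>

lemma ell_incseq:
  assumes m: "m \<in> carrier (sec M X)"
  shows "incseq (ell X f M act m \<alpha>)"
proof (rule incseq_SucI)
  fix k
  have mult: "\<exists>P'\<in>carrier (DXs X V). act V P' (m_fsk X f M V n k) = act V P (m_fsk X f M V n (Suc k))"
    if V: "openin (top_of X) V" and n: "n \<in> carrier (sec M V)" and P: "P \<in> carrier (DXs X V)" for V n P
  proof -
    interpret P: UP_ring "DX X V" "DXs X V" by (simp_all add: UP_ring_DXs[OF V])
    let ?g = "fun_act X M V (\<lambda>x. f x ^ k) n"
    have g: "?g \<in> carrier (sec M V)" by (rule power_act_closed[OF V n])
    have F: "const V (mul_op X V f) \<in> carrier (DXs X V)"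
      using const_closed[OF V] power_diff_ops[OF f V, of 1] by simp
    have "act V (const V (mul_op X V f)) (m_fsk X f M V n k) = m_fsk X f M V n (Suc k)"
      using act_fun_term[OF V g power_Hol[OF V, of 1], of 0] power_Suc_act[OF V n, of k]
      by (simp add: m_fsk_def mul_op_restr)
    then have "act V (P \<otimes>\<^bsub>DXs X V\<^esub> const V (mul_op X V f)) (m_fsk X f M V n k) = act V P (m_fsk X f M V n (Suc k))"
      using E.mult_smult[OF V ms_term_closed[OF V g, of 0] P F] by (simp add: m_fsk_def Ms_fs_simps)
    then show ?thesis using P.UP_mult_closed[OF P F] by blast
  qed
  have res: "res M X V m \<in> carrier (sec M V)" if "openin (top_of X) V" for V
    using M.res_closed[OF openin_self that openin_sub[OF that] m] .
  show "ell X f M act m \<alpha> k \<le> ell X f M act m \<alpha> (Suc k)"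
    unfolding ell_def
  proof (rule Inf_superset_mono, safe, goal_cases)
    case (1 _ l)
    have "\<exists>V. openin (top_of X) V \<and> x \<in> V \<and>
       (\<exists>P\<in>carrier (DXs X V). \<exists>q\<in>carrier (sec (Ms_fs X M act) V).
          act V P (m_fsk X f M V (res M X V m) k)
          = act V (s_plus X V \<alpha> [^]\<^bsub>DXs X V\<^esub> l) (m_fsk X f M V (res M X V m) 0)
            \<oplus>\<^bsub>sec (Ms_fs X M act) V\<^esub>
            act V (s_plus X V \<alpha> [^]\<^bsub>DXs X V\<^esub> (l + 1)) q)" if x: "x \<in> X" for x
    proof -
      obtain V P q where V: "openin (top_of X) V" "x \<in> V" and P: "P \<in> carrier (DXs X V)"
        and q: "q \<in> carrier (sec (Ms_fs X M act) V)"
        and eq: "act V P (m_fsk X f M V (res M X V m) (Suc k))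
          = act V (s_plus X V \<alpha> [^]\<^bsub>DXs X V\<^esub> l) (m_fsk X f M V (res M X V m) 0)
            \<oplus>\<^bsub>sec (Ms_fs X M act) V\<^esub>
            act V (s_plus X V \<alpha> [^]\<^bsub>DXs X V\<^esub> (l + 1)) q"
        using 1[rule_format, OF x] by blast
      obtain P' where "P' \<in> carrier (DXs X V)"
        "act V P' (m_fsk X f M V (res M X V m) k) = act V P (m_fsk X f M V (res M X V m) (Suc k))"
        using mult[OF V(1) res[OF V(1)] P] by blast
      then show ?thesis using V q eq by (intro exI[of _ V] conjI bexI[of _ P'] bexI[of _ q]) simp_all
    qed
    then show ?case by blast
  qed
qed

lemma omega_eq_0_iff:
  assumes m: "m \<in> carrier (sec M X)"
  shows "omega X f M act m 0 = 0 \<longleftrightarrow> (\<forall>k. ell X f M act m 0 k = 0)"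
proof -
  have "omega X f M act m 0 = (SUP k. ell X f M act m 0 k)"
    unfolding omega_def by (rule limI[OF LIMSEQ_SUP[OF ell_incseq[OF m]]])
  then show ?thesis by (simp add: SUP_eq_iff bot_enat_def[symmetric] SUP_bot_conv)
qed

end

theorem proposition1p2:
  fixes X :: "(complex^'N) set set"
    and f :: "(complex^'N) set \<Rightarrow> complex"
    and S M :: "((complex^'N) set, (complex^'N) set operator, 'b) msheaf"
    and act :: "(complex^'N) set set \<Rightarrow> (nat \<Rightarrow> (complex^'N) set operator) \<Rightarrow> (nat \<Rightarrow> 'b) \<Rightarrow> (nat \<Rightarrow> 'b)"
    and m :: 'b
  assumes "quasi_projective_manifold X"
    and "f \<in> Hol X X"
    and "\<not> (\<exists>g\<in>Hol X X. \<forall>x\<in>X. f x * g x = 1)"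
    and "holonomic X S"
    and "simple_DX_module X S"
    and "localization_along X f S M"
    and "\<not> zero_msheaf (top_of X) M"
    and "is_fs_action X f M act"
    and "m \<in> carrier (sec M X)"
  shows "m \<in> carrier (sec S X) \<longleftrightarrow> omega X f M act m 0 = 0"
proof -
  define N where "N = (\<lambda>U. carrier (sec S U))"
  note loc = assms(6)[unfolded localization_along_def, folded N_def]
  have "X \<subseteq> proj_space"
    using assms(1) unfolding quasi_projective_manifold_def zariski_closed_def proj_space_def by blast
  then interpret projective_set X by unfold_locales
  interpret fs_module X f M act
    using assms(2,8) loc by unfold_locales simp_all
  have N: "submodule_sheaf (top_of X) (DX X) M N" and S: "S = sub_msheaf M N"
    and bij: "\<And>U. openin (top_of X) U \<Longrightarrow> bij_betw (fun_act X M U f) (carrier (sec M U)) (carrier (sec M U))"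
    and clear: "\<And>U x n. openin (top_of X) U \<Longrightarrow> x \<in> U \<Longrightarrow> n \<in> carrier (sec M U) \<Longrightarrow>
      \<exists>V k. openin (top_of X) V \<and> x \<in> V \<and> V \<subseteq> U \<and> fun_act X M V (\<lambda>y. f y ^ k) (res M U V n) \<in> N V"
    using loc unfolding N_def by blast+
  note m = assms(9)
  have resX: "res M X V m \<in> carrier (sec M V)" if "openin (top_of X) V" for V
    using M.res_closed[OF openin_self that openin_sub[OF that] m] .
  show ?thesis
    unfolding omega_eq_0_iff[OF m] ell_eq_0_iff[OF m]
  proof
    assume "m \<in> carrier (sec S X)"
    then have mN: "m \<in> N X" by (simp add: N_def)
    show "\<forall>k. \<forall>x\<in>X. \<exists>V. openin (top_of X) V \<and> x \<in> V \<and>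
      (\<exists>P\<in>diff_ops X V. P \<odot>\<^bsub>sec M V\<^esub> fun_act X M V (\<lambda>x. f x ^ k) (res M X V m) = res M X V m)"
    proof (intro allI ballI)
      fix k x assume x: "x \<in> X"
      let ?u = "fun_act X M X (\<lambda>x. f x ^ k) m"
      interpret X: abelian_group "sec M X" by (rule M.sec_group[OF openin_self])
      \<comment> \<open>\<open>f\<close> acts injectively on \<open>M\<close>.\<close>
      have u_zero: "?u = \<zero>\<^bsub>sec M X\<^esub> \<Longrightarrow> m = \<zero>\<^bsub>sec M X\<^esub>"
      proof (induction k)
        case 0
        then show ?case using power_0_act[OF openin_self m] by simp
      next
        case (Suc k)
        have f_diff: "mul_op X X f \<in> carrier (DX X X)"
          using power_diff_ops[OF f openin_self, of 1] by (simp add: DX_simps)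
        have "fun_act X M X f (fun_act X M X (\<lambda>x. f x ^ k) m) = fun_act X M X f \<zero>\<^bsub>sec M X\<^esub>"
          using Suc.prems power_Suc_act[OF openin_self m, of k] M.smult_zero[OF openin_self f_diff] by simp
        then have "fun_act X M X (\<lambda>x. f x ^ k) m = \<zero>\<^bsub>sec M X\<^esub>"
          using bij[OF openin_self] power_act_closed[OF openin_self m]
          by (meson X.zero_closed bij_betw_imp_inj_on inj_onD)
        then show ?case by (rule Suc.IH)
      qed
      show "\<exists>V. openin (top_of X) V \<and> x \<in> V \<and>
        (\<exists>P\<in>diff_ops X V. P \<odot>\<^bsub>sec M V\<^esub> fun_act X M V (\<lambda>x. f x ^ k) (res M X V m) = res M X V m)"
      proof (cases "?u = \<zero>\<^bsub>sec M X\<^esub>")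
        case True
        \<comment> \<open>Here \<open>m = 0\<close>, and the identity operator maps \<open>f\<^sup>k m = 0\<close> to \<open>m\<close>.\<close>
        then have "?u = m" using u_zero by simp
        then have "mul_op X X (\<lambda>x. 1) \<odot>\<^bsub>sec M X\<^esub> fun_act X M X (\<lambda>x. f x ^ k) (res M X X m) = res M X X m"
          using M.one_smult[OF openin_self m] M.res_self[OF openin_self m] by (simp add: DX_simps)
        then show ?thesis using openin_self x one_diff_ops by blast
      next
        case False
        have uS: "?u \<in> carrier (sec S X)" "?u \<noteq> \<zero>\<^bsub>sec S X\<^esub>"
          using M.submodule_smult[OF N openin_self _ mN] power_diff_ops[OF f openin_self] False
          by (simp_all add: S sub_msheaf_simps DX_simps)
        have coh: "coherent (top_of X) (DX X) op_res S"
          using assms(4) by (simp add: holonomic_def)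
        obtain V r where V: "openin (top_of X) V" "x \<in> V" and r: "r \<in> diff_ops X V"
          and eq: "res S X V m = r \<odot>\<^bsub>sec S V\<^esub> res S X V ?u"
          using simple_generated[OF assms(5) coh uS \<open>m \<in> carrier (sec S X)\<close> x] .
        have "res M X V m = r \<odot>\<^bsub>sec M V\<^esub> fun_act X M V (\<lambda>x. f x ^ k) (res M X V m)"
          using eq power_act_res[OF openin_self V(1) openin_sub[OF V(1)] m, of k]
          by (simp add: S sub_msheaf_simps)
        then show ?thesis using V r by metis
      qed
    qed
  next
    assume gen: "\<forall>k. \<forall>x\<in>X. \<exists>V. openin (top_of X) V \<and> x \<in> V \<and>
      (\<exists>P\<in>diff_ops X V. P \<odot>\<^bsub>sec M V\<^esub> fun_act X M V (\<lambda>x. f x ^ k) (res M X V m) = res M X V m)"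
    have "m \<in> N X"
    proof (rule M.submodule_local[OF N openin_self m])
      fix x assume x: "x \<in> X"
      \<comment> \<open>The exponent \<open>k\<close> clears the denominator of \<open>m\<close> near \<open>x\<close>; the operator \<open>P\<close> for this \<open>k\<close>
        returns \<open>m\<close> from \<open>f\<^sup>k m\<close> without leaving \<open>S\<close>.\<close>
      obtain V k where V: "openin (top_of X) V" "x \<in> V" "V \<subseteq> X"
        and fk: "fun_act X M V (\<lambda>y. f y ^ k) (res M X V m) \<in> N V"
        using clear[OF openin_self x m] by blast
      obtain V' P where V': "openin (top_of X) V'" "x \<in> V'" and P: "P \<in> diff_ops X V'"
        and eq: "P \<odot>\<^bsub>sec M V'\<^esub> fun_act X M V' (\<lambda>x. f x ^ k) (res M X V' m) = res M X V' m"
        using gen x by blast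
      define W where "W = V \<inter> V'"
      have W: "openin (top_of X) W" "x \<in> W" "W \<subseteq> V" "W \<subseteq> V'" "W \<subseteq> X"
        using V V' by (auto simp: W_def)
      have V'X: "V' \<subseteq> X" by (rule openin_sub[OF V'(1)])
      let ?g = "fun_act X M W (\<lambda>x. f x ^ k) (res M X W m)"
      have "?g = res M V W (fun_act X M V (\<lambda>y. f y ^ k) (res M X V m))"
        using power_act_res[OF V(1) W(1,3) resX[OF V(1)]] M.res_res[OF openin_self V(1) W(1,3) V(3) m] by simp
      then have "?g \<in> N W" using M.submodule_res[OF N V(1) W(1,3) fk] by simp
      then have "op_res W P \<odot>\<^bsub>sec M W\<^esub> ?g \<in> N W"
        using M.submodule_smult[OF N W(1)] diff_ops_res[OF P W(1,4)] by (simp add: DX_simps)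
      moreover have "op_res W P \<odot>\<^bsub>sec M W\<^esub> ?g = res M X W m"
        using arg_cong[OF eq, of "res M V' W"] P
          M.res_smult[OF V'(1) W(1,4) power_act_closed[OF V'(1) resX[OF V'(1)]], of P]
          power_act_res[OF V'(1) W(1,4) resX[OF V'(1)]] M.res_res[OF openin_self V'(1) W(1,4) V'X m]
        by (simp add: DX_simps)
      ultimately show "\<exists>W. openin (top_of X) W \<and> x \<in> W \<and> W \<subseteq> X \<and> res M X W m \<in> N W"
        using W by auto
    qed
    then show "m \<in> carrier (sec S X)" by (simp add: N_def)
  qed
qed

end
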